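(* Let $1\le s_1<s_2<\dots<s_k$ be fixed integers, $k\ge1$. For each integer $n>2s_k$ such that the circulant graph $C_n(s_1,\dots,s_k)$ is connected (i.e. $\gcd(s_1,\dots,s_k,n)=1$), let $\tau(n)$ be its number of spanning trees. Let $p$ be the number of odd elements in the sequence $s_1,\dots,s_k$ and let $q$ be the square-free part of $p$. Then there exists an integer sequence $a(n)$ such that for all such $n$: $1^0$. $\tau(n)=n\,a(n)^2$ if $n$ is odd; $2^0$. $\tau(n)=q\,n\,a(n)^2$ if $n$ is even.
   Context: $C_n(s_1,\dots,s_k)$ is the graph with vertices $0,1,\dots,n-1$ in which each vertex $i$ is adjacent to the vertices $i\pm s_1,\dots,i\pm s_k\pmod n$. Any positive integer $p$ can be uniquely written as $p=q\,r^2$ with $q,r$ positive integers and $q$ square-free; $q$ is called the square-free part of $p$. (The number $q$ is used only when $n$ is even; in that case connectedness forces $p\ge1$, so $q$ is defined.) *)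

theory Defs
  imports
    "Graph_Theory.Graph_Theory"
    "HOL-Computational_Algebra.Squarefree"
    "HOL-Number_Theory.Cong"
begin

text \<open>
  Undirected graphs are represented as symmetric pair digraphs: an undirected edge
  is a pair of opposite arcs.
\<close>

definition circulant :: "nat \<Rightarrow> nat set \<Rightarrow> nat pair_pre_digraph" where
  "circulant n S =
     \<lparr> pverts = {0..<n},
       parcs = {(i, j). i < n \<and> j < n \<and>
         (\<exists>s\<in>S. [int j = int i + int s] (mod int n) \<or> [int j = int i - int s] (mod int n))} \<rparr>"

lemma pair_graph_circulant:
  assumes "\<And>s. s \<in> S \<Longrightarrow> 0 < s \<and> 2 * s < n"
  shows "pair_graph (circulant n S)"
proof
  show "finite (parcs (circulant n S))"
    by (rule finite_subset[of _ "{0..<n} \<times> {0..<n}"]) (auto simp: circulant_def)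
next
  show "symmetric (with_proj (circulant n S))"
    unfolding symmetric_def with_proj_simps
  proof (rule symI)
    fix i j assume "(i, j) \<in> parcs (circulant n S)"
    then obtain s where "s \<in> S" "i < n" "j < n"
      and "[int j = int i + int s] (mod int n) \<or> [int j = int i - int s] (mod int n)"
      by (auto simp: circulant_def)
    then have "[int i = int j - int s] (mod int n) \<or> [int i = int j + int s] (mod int n)"
      unfolding cong_iff_dvd_diff
      by (metis add_diff_cancel_left' diff_diff_eq2 diff_add_eq dvd_minus_iff minus_diff_eq add.commute)
    with \<open>s \<in> S\<close> \<open>i < n\<close> \<open>j < n\<close> show "(j, i) \<in> parcs (circulant n S)"
      by (auto simp: circulant_def)
  qed
next
  fix e assume e: "e \<in> parcs (circulant n S)"
  show "fst e \<noteq> snd e"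
  proof
    assume "fst e = snd e"
    with e obtain s where s: "s \<in> S"
      and "[int (fst e) = int (fst e) + int s] (mod int n)
        \<or> [int (fst e) = int (fst e) - int s] (mod int n)"
      by (auto simp: circulant_def)
    then have "int n dvd int s"
      by (auto simp: cong_iff_dvd_diff)
    then have "n dvd s"
      by simp
    with assms[OF s] show False
      by (auto dest: dvd_imp_le)
  qed
qed (auto simp: circulant_def)

text \<open>
  The library's \<^const>\<open>spanning_tree\<close> is a notion for directed graphs: its acyclicity
  condition forbids directed cycles only, and counts an edge traversed back and forth
  as a cycle of length two. In a symmetric loop-free digraph the cycles of the
  underlying undirected graph are the cycles with at least three arcs.
\<close>

definition undirected_tree :: "'a pair_pre_digraph \<Rightarrow> bool" where
  "undirected_tree T \<longleftrightarrow>
     symmetric (with_proj T) \<and> Digraph_Component.connected (with_proj T) \<and>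
     \<not> (\<exists>c. pre_digraph.cycle (with_proj T) c \<and> 3 \<le> length c)"

definition num_spanning_trees :: "'a pair_pre_digraph \<Rightarrow> nat" where
  "num_spanning_trees G =
     card {T :: 'a pair_pre_digraph. spanning (with_proj T) (with_proj G) \<and> undirected_tree T}"

lemma squarefree_part_unique:
  fixes p q r :: nat
  assumes "p = q * r\<^sup>2" "squarefree q" "0 < p"
  shows "squarefree_part p = q"
proof -
  have "q \<noteq> 0" "r \<noteq> 0" using assms by auto
  have "multiplicity x (squarefree_part p) = multiplicity x q" if "prime x" for x
  proof -
    have "multiplicity x p = multiplicity x q + 2 * multiplicity x r"
      using assms(1) that \<open>q \<noteq> 0\<close> \<open>r \<noteq> 0\<close>
      by (simp add: prime_elem_multiplicity_mult_distrib prime_elem_multiplicity_power_distrib)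
    moreover have "multiplicity x q \<le> 1"
      using assms(2) that \<open>q \<noteq> 0\<close> by (auto simp: squarefree_factorial_semiring'')
    ultimately show ?thesis
      using that by (simp add: prime_multiplicity_squarefree_part)
  qed
  then have "normalize (squarefree_part p) = normalize q"
    using \<open>q \<noteq> 0\<close> by (intro multiplicity_eq_imp_eq) auto
  then show ?thesis by simp
qed

end

theory Submission
  imports Defs Complex_Main "Jordan_Normal_Form.Determinant"
begin

text \<open>
  By the matrix-tree theorem the number \<open>\<tau>(n)\<close> of spanning trees is the determinant of the
  reduced Laplacian, and for a circulant graph this is \<open>1/n\<close> times the product of the
  eigenvalues \<open>\<lambda>\<^sub>j = \<Sum>s (2 - z\<^sup>s - z\<^bsup>-s\<^esup>)\<close> with \<open>0 < j < n\<close>, where \<open>z\<close> is the \<open>j\<close>-th power of a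
  primitive \<open>n\<close>-th root of unity.

  Each \<open>\<lambda>\<^sub>j\<close> is divisible by the corresponding eigenvalue \<open>2 - z - z\<^bsup>-1\<^esup>\<close> of the cycle. The
  quotient \<open>\<mu>\<^sub>j\<close> is an integral palindromic Laurent polynomial in \<open>z\<close>. As the eigenvalues of the
  cycle multiply to \<open>n\<^sup>2\<close>, the number of spanning trees is \<open>n\<close> times the product of all \<open>\<mu>\<^sub>j\<close>
  (\<open>num_spanning_trees_circulant\<close>). Now \<open>\<mu>\<^sub>j = \<mu>\<^bsub>n-j\<^esub>\<close>, so this product is the square of the
  product over \<open>1 \<le> j \<le> (n - 1) div 2\<close>, except that for even \<open>n\<close> the factor at \<open>j = n/2\<close> is left
  over. There \<open>z = -1\<close> and the factor is the number \<open>p\<close> of odd elements, that is, \<open>q\<close> times a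
  square.

  It remains to see that the half product is an integer. The multiplication operator by the
  quotient polynomial acts on antisymmetric functions on the integers modulo \<open>n\<close> by an integer
  matrix, and the sine functions diagonalize it with eigenvalues exactly the \<open>\<mu>\<^sub>j\<close> with
  \<open>1 \<le> j \<le> (n - 1) div 2\<close>. So the half product is an integer determinant
  (\<open>det_half_circulant\<close>).

  The matrix-tree theorem is proved by expanding the determinant row by row. Each term selects
  one neighbour for every vertex other than the root. The term is one if all vertices reach the
  root by following the selected neighbours, and zero otherwise, and the selections of the first
  kind are the spanning trees with every vertex pointing to its parent.
\<close>

section \<open>Spanning trees as parent maps\<close>

text \<open>
  Rooting a spanning tree of a graph on \<open>{0..<n}\<close> at vertex \<open>0\<close> and sending every other vertex
  to its neighbour on the way to the root encodes the tree as a function, and these functions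
  are what the expansion of a determinant along its rows enumerates. A map is the identity
  outside \<open>{1..<n}\<close>, so that distinct maps differ on the non-root vertices.
\<close>

definition parent_maps :: "nat \<Rightarrow> (nat \<times> nat) set \<Rightarrow> (nat \<Rightarrow> nat) set" where
  "parent_maps n E =
     {f. (\<forall>v\<in>{1..<n}. (v, f v) \<in> E) \<and> (\<forall>v. v \<notin> {1..<n} \<longrightarrow> f v = v) \<and>
         (\<forall>v<n. \<exists>k. (f ^^ k) v = 0)}"

definition tree_of_parents :: "nat \<Rightarrow> (nat \<Rightarrow> nat) \<Rightarrow> nat pair_pre_digraph" where
  "tree_of_parents n f =
     \<lparr> pverts = {0..<n}, parcs = (\<lambda>v. (v, f v)) ` {1..<n} \<union> (\<lambda>v. (f v, v)) ` {1..<n} \<rparr>"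

definition depth :: "(nat \<Rightarrow> nat) \<Rightarrow> nat \<Rightarrow> nat" where
  "depth f v = (LEAST k. (f ^^ k) v = 0)"

lemma depth_parent:
  assumes "f \<in> parent_maps n E" "v \<in> {1..<n}"
  shows "depth f v = Suc (depth f (f v))"
proof -
  obtain k where "(f ^^ k) v = 0"
    using assms by (auto simp: parent_maps_def)
  moreover have "(f ^^ 0) v \<noteq> 0"
    using assms(2) by simp
  ultimately have "(LEAST k. (f ^^ k) v = 0) = Suc (LEAST k. (f ^^ Suc k) v = 0)"
    by (rule Least_Suc)
  then show ?thesis
    by (simp only: depth_def funpow_Suc_right o_apply)
qed

lemma tl_pawalk_verts:
  assumes "pcas u c v"
  shows "tl (pawalk_verts u c) = map snd c"
proof -
  have "pawalk_verts u c = u # map snd c"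
    using assms by (induction c arbitrary: u) auto
  then show ?thesis by simp
qed

text \<open>
  The heads of the arcs of a closed walk are its vertices without the initial one, so a cycle
  is a closed walk whose arcs have distinct heads.
\<close>

lemma cycle_with_proj_iff:
  "pre_digraph.cycle (with_proj T) c \<longleftrightarrow>
     c \<noteq> [] \<and> set c \<subseteq> parcs T \<and> distinct (map snd c) \<and> (\<exists>u\<in>pverts T. pcas u c u)"
  unfolding pre_digraph.cycle_def pre_digraph.awalk_def cas_with_proj_eq awalk_verts_with_proj_eq
  by (auto simp: tl_pawalk_verts)

lemma pcas_nth_Suc:
  assumes "pcas u c v" "Suc i < length c"
  shows "fst (c ! Suc i) = snd (c ! i)"
  using assms
proof (induction c arbitrary: u i)
  case (Cons e c)
  then show ?case
    by (cases i; cases c) auto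
qed simp

lemma pcas_last:
  assumes "pcas u c v" "c \<noteq> []"
  shows "snd (last c) = v"
  using assms by (induction c arbitrary: u) auto

lemma cycle_next_arc:
  assumes "pre_digraph.cycle (with_proj T) c" "i < length c"
  shows "fst (c ! (Suc i mod length c)) = snd (c ! i)"
proof -
  obtain u where cas: "pcas u c u" and "c \<noteq> []"
    using assms(1) by (auto simp: cycle_with_proj_iff)
  show ?thesis
  proof (cases "Suc i = length c")
    case True
    moreover have "fst (c ! 0) = u"
      using cas \<open>c \<noteq> []\<close> by (cases c) auto
    ultimately show ?thesis
      using pcas_last[OF cas \<open>c \<noteq> []\<close>] \<open>c \<noteq> []\<close> by (simp add: last_conv_nth flip: True)
  next
    case False
    then show ?thesis
      using assms(2) pcas_nth_Suc[OF cas, of i] by simp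
  qed
qed

lemma Suc_mod_surj:
  assumes "i < (m::nat)"
  obtains h where "h < m" "Suc h mod m = i"
proof (cases i)
  case 0
  then show ?thesis using that[of "m - 1"] assms by simp
next
  case (Suc h)
  then show ?thesis using that[of h] assms by simp
qed

lemma cycle_predecessor:
  assumes "pre_digraph.cycle (with_proj T) c" "i < length c"
  shows "\<exists>h<length c. snd (c ! h) = fst (c ! i)"
  using Suc_mod_surj[OF assms(2)] cycle_next_arc[OF assms(1)] by metis

text \<open>
  If the walk came back to the tail of its \<open>i\<close>-th arc two steps later, distinctness of the heads
  would make the indices \<open>i - 1\<close> and \<open>i + 1\<close> equal modulo the length of the cycle, so the length
  would be at most two.
\<close>

lemma cycle_two_neighbours:
  assumes "pre_digraph.cycle (with_proj T) c" "3 \<le> length c" "i < length c"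
  shows "\<exists>j<length c. fst (c ! j) = snd (c ! i) \<and> snd (c ! j) \<noteq> fst (c ! i)"
proof -
  let ?m = "length c"
  have "distinct (map snd c)"
    using assms(1) by (auto simp: cycle_with_proj_iff)
  note next_arc = cycle_next_arc[OF assms(1)]
  obtain h where h: "h < ?m" "Suc h mod ?m = i"
    using Suc_mod_surj[OF assms(3)] .
  have i': "Suc i mod ?m < ?m"
    using assms(3) by (intro mod_less_divisor) auto
  have "snd (c ! (Suc i mod ?m)) \<noteq> fst (c ! i)"
  proof
    assume "snd (c ! (Suc i mod ?m)) = fst (c ! i)"
    then have "map snd c ! (Suc i mod ?m) = map snd c ! h"
      using next_arc[OF h(1)] h i' by simp
    then have "Suc i mod ?m = h"
      using \<open>distinct (map snd c)\<close> h(1) i' by (subst (asm) nth_eq_iff_index_eq) auto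
    then have "Suc (Suc h mod ?m) mod ?m = h"
      using h by simp
    then have "Suc (Suc h) mod ?m = h"
      by (simp add: mod_Suc_eq)
    then show False
      using h(1) assms(2) by (auto simp: mod_if split: if_splits)
  qed
  then show ?thesis
    using next_arc[OF assms(3)] i' by blast
qed

lemma successively_zip_tl:
  assumes "successively (\<lambda>x y. (x, y) \<in> E) vs"
  shows "set (zip vs (tl vs)) \<subseteq> E"
  using assms by (induction vs rule: induct_list012) auto

lemma pcas_zip_tl:
  assumes "vs \<noteq> []"
  shows "pcas (hd vs) (zip vs (tl vs @ [w])) w"
  using assms by (induction vs rule: induct_list012) auto

lemma cycle_of_distinct_vertices:
  assumes "distinct vs" "vs \<noteq> []" "set vs \<subseteq> pverts T"
    and "successively (\<lambda>x y. (x, y) \<in> parcs T) (vs @ [hd vs])"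
  shows "pre_digraph.cycle (with_proj T) (zip vs (tl vs @ [hd vs]))"
proof -
  have "set (zip (vs @ [hd vs]) (tl (vs @ [hd vs]))) \<subseteq> parcs T"
    using assms(4) by (rule successively_zip_tl)
  moreover have "zip (vs @ [hd vs]) (tl (vs @ [hd vs])) = zip vs (tl vs @ [hd vs])"
    unfolding zip_append1 using assms(2) by (cases vs) auto
  ultimately have arcs: "set (zip vs (tl vs @ [hd vs])) \<subseteq> parcs T" by simp
  have "pcas (hd vs) (zip vs (tl vs @ [hd vs])) (hd vs)"
    using assms(2) by (rule pcas_zip_tl)
  moreover have "distinct (map snd (zip vs (tl vs @ [hd vs])))"
    using assms(1,2) by (cases vs) auto
  moreover have "hd vs \<in> pverts T" "zip vs (tl vs @ [hd vs]) \<noteq> []"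
    using assms(2,3) by (cases vs; auto)+
  ultimately show ?thesis
    unfolding cycle_with_proj_iff using arcs by auto
qed

lemma parent_maps_less:
  assumes "f \<in> parent_maps n E" "E \<subseteq> {0..<n} \<times> {0..<n}" "v < n"
  shows "f v < n"
proof (cases "v \<in> {1..<n}")
  case True
  then have "(v, f v) \<in> E" using assms(1) by (simp add: parent_maps_def)
  then show ?thesis using assms(2) by auto
next
  case False
  then have "f v = v" using assms(1) by (simp add: parent_maps_def)
  then show ?thesis using assms(3) by simp
qed

lemma parcs_tree_of_parents_iff:
  "(x, y) \<in> parcs (tree_of_parents n f) \<longleftrightarrow> x \<in> {1..<n} \<and> y = f x \<or> y \<in> {1..<n} \<and> x = f y"
  by (auto simp: tree_of_parents_def)

text \<open>
  Every neighbour of a vertex other than its parent lies one level deeper. Hence the deepest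
  vertex of a cycle has its parent as both neighbours on the cycle, which is impossible for
  cycles of length at least three.
\<close>

lemma tree_of_parents_acyclic:
  assumes depth: "\<And>v. v \<in> {1..<n} \<Longrightarrow> d v = Suc (d (f v))"
    and cyc: "pre_digraph.cycle (with_proj (tree_of_parents n f)) c"
  shows "length c < 3"
proof (rule ccontr)
  let ?E = "parcs (tree_of_parents n f)"
  assume "\<not> length c < 3"
  then have c: "3 \<le> length c" by simp
  have up: "y = f x" if "(x, y) \<in> ?E" "d y \<le> d x" for x y
    using that depth[of y] by (auto simp: parcs_tree_of_parents_iff)
  have sub: "set c \<subseteq> ?E"
    using cyc by (simp add: cycle_with_proj_iff)
  define M where "M = Max ((d \<circ> snd) ` set c)"
  have "M \<in> (d \<circ> snd) ` set c"
    unfolding M_def using c by (intro Max_in) auto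
  then obtain i where i: "i < length c" "d (snd (c ! i)) = M"
    by (auto simp: in_set_conv_nth)
  have le: "d (snd e) \<le> M" if "e \<in> set c" for e
    unfolding M_def using that by (intro Max_ge) auto
  obtain j where j: "j < length c" "fst (c ! j) = snd (c ! i)" "snd (c ! j) \<noteq> fst (c ! i)"
    using cycle_two_neighbours[OF cyc c i(1)] by blast
  obtain h where h: "h < length c" "snd (c ! h) = fst (c ! i)"
    using cycle_predecessor[OF cyc i(1)] by blast
  have arc: "(fst (c ! k), snd (c ! k)) \<in> ?E" if "k < length c" for k
    using sub nth_mem[OF that] by auto
  have "snd (c ! j) = f (snd (c ! i))"
    using up[OF arc[OF j(1)]] le[OF nth_mem[OF j(1)]] i(2) j(2) by simp
  moreover have "(snd (c ! i), fst (c ! i)) \<in> ?E"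
    using arc[OF i(1)] unfolding parcs_tree_of_parents_iff by blast
  then have "fst (c ! i) = f (snd (c ! i))"
    using up le[OF nth_mem[OF h(1)]] i(2) h(2) by simp
  ultimately show False
    using j(3) by simp
qed

lemma undirected_tree_tree_of_parents:
  assumes f: "f \<in> parent_maps n E" and E: "E \<subseteq> {0..<n} \<times> {0..<n}" and "0 < n"
  shows "undirected_tree (tree_of_parents n f)"
proof -
  let ?T = "tree_of_parents n f"
  have less: "f v < n" if "v < n" for v
    using parent_maps_less[OF f E that] .
  have verts: "pverts ?T = {0..<n}"
    by (simp add: tree_of_parents_def)
  have sym: "symmetric (with_proj ?T)"
    unfolding symmetric_def with_proj_simps
    by (rule symI) (auto simp: parcs_tree_of_parents_iff)
  interpret pair_wf_digraph ?T
    by standard (use less in \<open>auto simp: tree_of_parents_def\<close>)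
  have to_root: "v \<rightarrow>\<^sup>*\<^bsub>with_proj ?T\<^esub> 0" if "v < n" for v
    using that
  proof (induction "depth f v" arbitrary: v rule: less_induct)
    case less_v: less
    show ?case
    proof (cases "v = 0")
      case True
      then show ?thesis using less_v.prems by (simp add: verts)
    next
      case False
      with less_v.prems have v: "v \<in> {1..<n}" by simp
      then have "f v \<rightarrow>\<^sup>*\<^bsub>with_proj ?T\<^esub> 0"
        using less_v.hyps[of "f v"] depth_parent[OF f v] less[OF less_v.prems] by simp
      moreover have "(v, f v) \<in> parcs ?T"
        using v by (simp add: parcs_tree_of_parents_iff)
      ultimately show ?thesis
        by (rule adj_reachable_trans[rotated])
    qed
  qed
  have reach: "u \<rightarrow>\<^sup>*\<^bsub>with_proj ?T\<^esub> v" if "u < n" "v < n" for u v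
    using to_root[OF that(1)] symmetric_reachable[OF sym to_root[OF that(2)]]
    by (rule reachable_trans)
  have "Digraph_Component.connected (with_proj ?T)"
    unfolding Digraph_Component.connected_def
    by (rule strongly_connectedI)
      (use \<open>0 < n\<close> verts in \<open>auto intro!: reachable_mk_symmetricI reach\<close>)
  then show ?thesis
    using sym tree_of_parents_acyclic[of n "depth f" f] depth_parent[OF f]
    by (auto simp: undirected_tree_def not_le[symmetric])
qed

text \<open>
  The parent of a vertex can be recovered from the tree by induction on the depth: an arc from
  \<open>v\<close> to \<open>f v\<close> that is not the parent arc of \<open>v\<close> under \<open>g\<close> makes \<open>v\<close> the \<open>g\<close>-parent of the
  shallower vertex \<open>f v\<close>, hence also its \<open>f\<close>-parent, contradicting the depths.
\<close>

lemma tree_of_parents_inject: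
  assumes f: "f \<in> parent_maps n E" and g: "g \<in> parent_maps n E"
    and eq: "tree_of_parents n f = tree_of_parents n g"
  shows "f = g"
proof
  fix v show "f v = g v"
  proof (induction "depth f v" arbitrary: v rule: less_induct)
    case less
    show ?case
    proof (cases "v \<in> {1..<n}")
      case False
      then show ?thesis using f g by (simp add: parent_maps_def)
    next
      case v: True
      then have "(v, f v) \<in> parcs (tree_of_parents n g)"
        by (simp add: parcs_tree_of_parents_iff flip: eq)
      then consider "f v = g v" | "f v \<in> {1..<n}" "v = g (f v)"
        by (auto simp: parcs_tree_of_parents_iff)
      then show ?thesis
      proof cases
        case 2
        have "depth f v = Suc (Suc (depth f (f (f v))))"
          using depth_parent[OF f v] depth_parent[OF f 2(1)] by simp
        moreover have "f (f v) = v"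
          using less[of "f v"] depth_parent[OF f v] 2(2) by simp
        ultimately show ?thesis by simp
      qed
    qed
  qed
qed

lemma successively_map_upt:
  assumes "\<And>a. Suc a < k \<Longrightarrow> R (g a) (g (Suc a))"
  shows "successively R (map g [0..<k])"
  using assms by (simp add: successively_conv_nth)

lemma undirected_tree_reaches:
  assumes "undirected_tree T" "pair_wf_digraph T" "u \<in> pverts T" "v \<in> pverts T"
  shows "(u, v) \<in> (parcs T)\<^sup>*"
proof -
  interpret pair_wf_digraph T by fact
  have "strongly_connected (with_proj T)"
    using assms(1) by (intro symmetric_connected_imp_strongly_connected) (auto simp: undirected_tree_def)
  then have "u \<rightarrow>\<^sup>*\<^bsub>with_proj T\<^esub> v"
    using assms(3,4) by (auto simp: strongly_connected_def)
  then show ?thesis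
    by (auto simp: reachable_conv)
qed

text \<open>
  Following parents from both ends of an arc outside the parent map leads to a common ancestor;
  up to the first such ancestor the two chains are disjoint, and together with the arc they
  form a cycle with at least three vertices.
\<close>

lemma undirected_tree_no_cross_arc:
  assumes T: "undirected_tree T" "pverts T = {0..<n}"
    and f: "f \<in> parent_maps n (parcs T)"
    and xy: "(x, y) \<in> parcs T" "x < n" "y < n" "x \<noteq> y"
    and less: "\<And>v. v < n \<Longrightarrow> f v < n"
  shows "y = f x \<or> x = f y"
proof (rule ccontr)
  assume neg: "\<not> (y = f x \<or> x = f y)"
  have symT: "sym (parcs T)"
    using T(1) by (simp add: undirected_tree_def symmetric_def)
  have f0: "f 0 = 0"
    using f by (simp add: parent_maps_def)
  have iter_less: "(f ^^ a) v < n" if "v < n" for a v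
    using that less by (induction a) auto
  have iter_0: "(f ^^ a) 0 = 0" for a
    using f0 by (induction a) auto
  have "\<forall>v<n. \<exists>k. (f ^^ k) v = 0"
    using f by (simp add: parent_maps_def)
  then obtain I J where IJ: "(f ^^ I) x = 0" "(f ^^ J) y = 0"
    using xy(2,3) by metis
  \<comment> \<open>Minimality of \<open>i\<close> and then of \<open>j\<close> makes the two chains disjoint before they meet.\<close>
  define i where "i = (LEAST i. \<exists>j. (f ^^ i) x = (f ^^ j) y)"
  have "\<exists>j. (f ^^ i) x = (f ^^ j) y"
    unfolding i_def by (rule LeastI[of _ I]) (use IJ in metis)
  define j where "j = (LEAST j. (f ^^ i) x = (f ^^ j) y)"
  have meet: "(f ^^ i) x = (f ^^ j) y"
    unfolding j_def by (rule LeastI_ex) fact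
  have apart: "(f ^^ a) x \<noteq> (f ^^ b) y" if "a < i \<or> a = i \<and> b < j" for a b
    using that
  proof (elim disjE conjE)
    assume "a < i"
    then show ?thesis
      unfolding i_def by (blast dest: not_less_Least)
  next
    assume "a = i" "b < j"
    then show ?thesis
      unfolding j_def by (blast dest: not_less_Least)
  qed
  have x_inner: "(f ^^ a) x \<in> {1..<n}" if "a < i" for a
    using apart[of a J] IJ(2) iter_less[OF xy(2), of a] that
    by (cases "(f ^^ a) x") auto
  have y_inner: "(f ^^ b) y \<in> {1..<n}" if "b < j" for b
  proof -
    have "(f ^^ b) y \<noteq> 0"
    proof
      assume "(f ^^ b) y = 0"
      moreover have "(f ^^ j) y = (f ^^ (j - b)) ((f ^^ b) y)"
        using that by (simp flip: funpow_add[THEN fun_cong, unfolded o_apply])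
      ultimately show False
        using apart[of i b] that meet iter_0 by simp
    qed
    then show ?thesis
      using iter_less[OF xy(3), of b] by (cases "(f ^^ b) y") auto
  qed
  have up: "(v, f v) \<in> parcs T" "(f v, v) \<in> parcs T" "depth f v = Suc (depth f (f v))"
    if "v \<in> {1..<n}" for v
    using that f symD[OF symT] depth_parent[OF f] by (auto simp: parent_maps_def)
  \<comment> \<open>Depths decrease strictly along each chain, so no chain repeats a vertex.\<close>
  have depth_x: "depth f x = a + depth f ((f ^^ a) x)" if "a \<le> i" for a
    using that
  proof (induction a)
    case (Suc a)
    then show ?case using up(3)[OF x_inner[of a]] by simp
  qed simp
  have depth_y: "depth f y = b + depth f ((f ^^ b) y)" if "b \<le> j" for b
    using that
  proof (induction b)
    case (Suc b)
    then show ?case using up(3)[OF y_inner[of b]] by simp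
  qed simp
  let ?p = "map (\<lambda>a. (f ^^ a) x) [0..<Suc i]"
  let ?q = "map (\<lambda>b. (f ^^ b) y) [0..<j]"
  let ?R = "\<lambda>u v. (u, v) \<in> parcs T"
  have "distinct ?p"
    unfolding distinct_map
  proof (intro conjI inj_onI)
    fix a b assume ab: "a \<in> set [0..<Suc i]" "b \<in> set [0..<Suc i]" and eq: "(f ^^ a) x = (f ^^ b) x"
    have "a \<le> i" "b \<le> i" using ab by auto
    from depth_x[OF this(1)] depth_x[OF this(2)] show "a = b" unfolding eq by linarith
  qed simp
  moreover have "distinct ?q"
    unfolding distinct_map
  proof (intro conjI inj_onI)
    fix a b assume ab: "a \<in> set [0..<j]" "b \<in> set [0..<j]" and eq: "(f ^^ a) y = (f ^^ b) y"
    have "a \<le> j" "b \<le> j" using ab by auto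
    from depth_y[OF this(1)] depth_y[OF this(2)] show "a = b" unfolding eq by linarith
  qed simp
  moreover have "set ?p \<inter> set ?q = {}"
    using apart by (auto simp: less_Suc_eq simp del: upt_Suc)
  ultimately have dist: "distinct (?p @ rev ?q)"
    by (simp only: distinct_append distinct_rev set_rev)
  have sp: "successively ?R ?p"
    by (rule successively_map_upt) (use up(1)[OF x_inner] in auto)
  have sq: "successively ?R (rev ?q)"
    unfolding successively_rev
    by (rule successively_map_upt) (use up(2)[OF y_inner] in auto)
  have hd_p: "hd (?p @ rev ?q) = x"
    by (simp add: hd_map del: upt_Suc)
  have yx: "(y, x) \<in> parcs T"
    using symD[OF symT xy(1)] .
  have "successively ?R (?p @ rev ?q @ [x])"
  proof (cases j)
    case 0
    then show ?thesis
      using sp yx meet by (simp add: successively_append_iff last_map)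
  next
    case (Suc j')
    have "(f ^^ j') y \<in> {1..<n}" using y_inner Suc by simp
    then have "?R (last ?p) (hd (rev ?q))"
      using Suc meet up(2) by (simp add: last_map hd_rev)
    moreover have "last (rev ?q) = y"
      using Suc by (simp add: last_rev hd_map del: upt_Suc)
    ultimately show ?thesis
      using sp sq yx Suc by (simp add: successively_append_iff del: upt_Suc)
  qed
  then have succ: "successively ?R ((?p @ rev ?q) @ [hd (?p @ rev ?q)])"
    by (simp only: hd_p append_assoc)
  have "set (?p @ rev ?q) \<subseteq> pverts T"
    using iter_less xy(2,3) T(2) by auto
  then have "pre_digraph.cycle (with_proj T) (zip (?p @ rev ?q) (tl (?p @ rev ?q) @ [hd (?p @ rev ?q)]))"
    using dist succ by (intro cycle_of_distinct_vertices) auto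
  moreover have "3 \<le> length (zip (?p @ rev ?q) (tl (?p @ rev ?q) @ [hd (?p @ rev ?q)]))"
  proof -
    \<comment> \<open>The cycle has \<open>i + j + 1\<close> vertices; \<open>i + j \<le> 1\<close> would mean a loop or a parent arc.\<close>
    have "i + j \<noteq> 0" using meet xy(4) by (cases "i = 0"; cases "j = 0") auto
    moreover have "i + j \<noteq> 1"
    proof
      assume "i + j = 1"
      then have "i = 0 \<and> j = 1 \<or> i = 1 \<and> j = 0" by auto
      then show False using meet neg by auto
    qed
    ultimately have "3 \<le> Suc i + j" by linarith
    then show ?thesis by simp
  qed
  ultimately show False
    using T(1) by (auto simp: undirected_tree_def)
qed

text \<open>
  The parent of \<open>v\<close> is a neighbour that is closer to the root in the tree, and distances to the
  root strictly decrease along parents.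
\<close>

lemma undirected_tree_is_tree_of_parents:
  assumes T: "undirected_tree T" and wf: "pair_wf_digraph T" and verts: "pverts T = {0..<n}"
    and loops: "\<And>v. (v, v) \<notin> parcs T"
  shows "\<exists>f\<in>parent_maps n (parcs T). T = tree_of_parents n f"
proof -
  interpret pair_wf_digraph T by fact
  let ?R = "parcs T"
  have arcs: "u < n \<and> v < n" if "(u, v) \<in> ?R" for u v
    using wellformed[OF that] verts by auto
  have symT: "sym ?R"
    using T by (simp add: undirected_tree_def symmetric_def)
  \<comment> \<open>\<open>d v\<close> is the distance from \<open>v\<close> to the root.\<close>
  define d where "d v = (LEAST k. (v, 0) \<in> ?R ^^ k)" for v
  have d: "(v, 0) \<in> ?R ^^ d v" if "v < n" for v
  proof -
    have "(v, 0) \<in> ?R\<^sup>*"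
      using undirected_tree_reaches[OF T wf] that verts by auto
    then show ?thesis
      unfolding d_def rtrancl_power by (rule LeastI_ex)
  qed
  have "\<exists>w. (v, w) \<in> ?R \<and> d v = Suc (d w)" if v: "v \<in> {1..<n}" for v
  proof -
    obtain k where k: "d v = Suc k"
      using d[of v] v by (cases "d v") auto
    have "(v, 0) \<in> ?R ^^ Suc k"
      using d[of v] v by (simp only: k atLeastLessThan_iff)
    then obtain w where w: "(v, w) \<in> ?R" "(w, 0) \<in> ?R ^^ k"
      by (blast dest: relpow_Suc_D2)
    have "d w \<le> k"
      unfolding d_def using w(2) by (rule Least_le)
    moreover have "d v \<le> Suc (d w)"
      unfolding d_def[of v]
    proof (rule Least_le)
      show "(v, 0) \<in> ?R ^^ Suc (d w)"
        using w(1) d[of w] arcs[OF w(1)] by (intro relpow_Suc_I2) auto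
    qed
    ultimately show ?thesis
      using w(1) k by (intro exI[of _ w]) auto
  qed
  then obtain g where g: "\<And>v. v \<in> {1..<n} \<Longrightarrow> (v, g v) \<in> ?R \<and> d v = Suc (d (g v))"
    by metis
  define f where "f v = (if v \<in> {1..<n} then g v else v)" for v
  have f: "(v, f v) \<in> ?R" "d v = Suc (d (f v))" if "v \<in> {1..<n}" for v
    using g[OF that] that by (simp_all add: f_def)
  have less: "f v < n" if "v < n" for v
    using arcs[OF f(1)] that by (cases "v \<in> {1..<n}") (auto simp: f_def)
  have "\<exists>k. (f ^^ k) v = 0" if "v < n" for v
    using that
  proof (induction "d v" arbitrary: v rule: less_induct)
    case less_v: less
    show ?case
    proof (cases "v = 0")
      case True
      then show ?thesis by (intro exI[of _ 0]) simp
    next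
      case False
      then have "v \<in> {1..<n}" using less_v.prems by simp
      then obtain k where "(f ^^ k) (f v) = 0"
        using less_v.hyps[of "f v"] f(2) less less_v.prems by auto
      then show ?thesis
        by (intro exI[of _ "Suc k"]) (simp only: funpow_Suc_right o_apply)
    qed
  qed
  then have pm: "f \<in> parent_maps n ?R"
    using f(1) by (auto simp: parent_maps_def f_def)
  have "parcs (tree_of_parents n f) = ?R"
  proof (intro equalityI subrelI)
    fix x y assume "(x, y) \<in> parcs (tree_of_parents n f)"
    then show "(x, y) \<in> ?R"
      using f(1) by (auto simp: parcs_tree_of_parents_iff intro: symD[OF symT])
  next
    fix x y assume xy: "(x, y) \<in> ?R"
    then have "x \<noteq> y" using loops by auto
    then have *: "y = f x \<or> x = f y"
      using undirected_tree_no_cross_arc[OF T verts pm xy] arcs[OF xy] less by blast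
    then show "(x, y) \<in> parcs (tree_of_parents n f)"
      using \<open>x \<noteq> y\<close> arcs[OF xy]
      by (cases "x = 0"; cases "y = 0") (auto simp: parcs_tree_of_parents_iff f_def)
  qed
  then have "T = tree_of_parents n f"
    using verts by (intro pair_pre_digraph.equality) (auto simp: tree_of_parents_def)
  then show ?thesis
    using pm by blast
qed

lemma num_spanning_trees_eq_card_parent_maps:
  assumes "pair_graph G" and verts: "pverts G = {0..<n}" and "0 < n"
  shows "num_spanning_trees G = card (parent_maps n (parcs G))"
proof -
  interpret G: pair_graph G by fact
  have E: "parcs G \<subseteq> {0..<n} \<times> {0..<n}"
    using G.wellformed verts by auto
  have symG: "sym (parcs G)"
    using G.sym_arcs by (simp add: symmetric_def)
  let ?Trees = "{T. spanning (with_proj T) (with_proj G) \<and> undirected_tree T}"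
  have "bij_betw (tree_of_parents n) (parent_maps n (parcs G)) ?Trees"
  proof (rule bij_betw_imageI)
    show "inj_on (tree_of_parents n) (parent_maps n (parcs G))"
      by (rule inj_onI) (rule tree_of_parents_inject)
    show "tree_of_parents n ` parent_maps n (parcs G) = ?Trees"
    proof (intro equalityI subsetI)
      fix T assume "T \<in> tree_of_parents n ` parent_maps n (parcs G)"
      then obtain f where f: "f \<in> parent_maps n (parcs G)" and T: "T = tree_of_parents n f"
        by blast
      have sub: "parcs T \<subseteq> parcs G"
        using f by (auto simp: T tree_of_parents_def parent_maps_def intro: symD[OF symG])
      have vertsT: "pverts T = {0..<n}"
        by (simp add: T tree_of_parents_def)
      have "pair_wf_digraph T"
      proof
        fix e assume "e \<in> parcs T"
        then have "e \<in> {0..<n} \<times> {0..<n}" using sub E by blast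
        then show "fst e \<in> pverts T" "snd e \<in> pverts T"
          unfolding vertsT by (simp_all add: mem_Times_iff)
      qed
      then have "spanning (with_proj T) (with_proj G)"
        using sub vertsT verts G.wf_digraph_axioms
        by (simp add: spanning_def subgraph_def compatible_def wf_digraph_wp_iff)
      then show "T \<in> ?Trees"
        using undirected_tree_tree_of_parents[OF f E \<open>0 < n\<close>] T by simp
    next
      fix T assume "T \<in> ?Trees"
      then have T: "undirected_tree T" "pair_wf_digraph T" "pverts T = {0..<n}" "parcs T \<subseteq> parcs G"
        by (auto simp: spanning_def subgraph_def verts wf_digraph_wp_iff)
      moreover have "(v, v) \<notin> parcs T" for v
        using T(4) G.no_loops by fastforce
      ultimately obtain f where "f \<in> parent_maps n (parcs T)" "T = tree_of_parents n f"
        using undirected_tree_is_tree_of_parents by blast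
      moreover have "parent_maps n (parcs T) \<subseteq> parent_maps n (parcs G)"
        using T(4) by (auto simp: parent_maps_def)
      ultimately show "T \<in> tree_of_parents n ` parent_maps n (parcs G)"
        by blast
    qed
  qed
  then show ?thesis
    unfolding num_spanning_trees_def by (rule bij_betw_same_card[symmetric])
qed

section \<open>The matrix-tree theorem\<close>

text \<open>
  The row of a vertex \<open>v\<close> is the sum of \<open>e\<^sub>v - e\<^sub>w\<close> over its neighbours \<open>w\<close>, which is the usual
  Laplacian row in a form suited to multilinear expansion. Replacing the row of the root by
  \<open>e\<^sub>0\<close> has the same effect on the determinant as deleting the row and column of the root, but
  keeps vertices and indices in step.
\<close>

definition reduced_laplacian :: "nat \<Rightarrow> (nat \<times> nat) set \<Rightarrow> int mat" where
  "reduced_laplacian n E = mat n n (\<lambda>(v, u).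
     if v = 0 then of_bool (u = 0)
     else \<Sum>w\<in>{w. (v, w) \<in> E}. of_bool (u = v) - of_bool (u = w))"

definition parent_matrix :: "nat \<Rightarrow> (nat \<Rightarrow> nat) \<Rightarrow> int mat" where
  "parent_matrix n f = mat n n (\<lambda>(v, u).
     of_bool (u = v) - (if v = 0 then 0 else of_bool (u = f v)))"

text \<open>
  A permutation contributing to the Leibniz formula maps every vertex to itself or to its
  parent. If it moves some vertex, it moves the parent too, and so on, so that the chain of
  parents never ends at the root. Only the identity remains.
\<close>

lemma det_parent_matrix_acyclic:
  assumes "f \<in> parent_maps n E"
  shows "det (parent_matrix n f) = 1"
proof -
  let ?A = "parent_matrix n f"
  have f: "f v = v" if "v \<notin> {1..<n}" for v
    using assms that by (simp add: parent_maps_def)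
  have no_fix: "f v \<noteq> v" if "v \<in> {1..<n}" for v
    using depth_parent[OF assms that] by auto
  have moved: "(\<Prod>i = 0..<n. ?A $$ (i, p i)) = 0" if p: "p permutes {0..<n}" "p \<noteq> id" for p
  proof (rule ccontr)
    assume nz: "(\<Prod>i = 0..<n. ?A $$ (i, p i)) \<noteq> 0"
    have "p v = v \<or> v \<noteq> 0 \<and> p v = f v" if "v < n" for v
    proof -
      have "?A $$ (v, p v) \<noteq> 0" "p v < n"
        using nz that permutes_in_image[OF p(1), of v] by auto
      then show ?thesis
        using that by (auto simp: parent_matrix_def split: if_splits)
    qed
    then have step: "v \<noteq> 0 \<and> f v < n \<and> p (f v) \<noteq> f v" if "v < n" "p v \<noteq> v" for v
      using that permutes_in_image[OF p(1), of v] permutes_inj[OF p(1)]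
      by (metis atLeastLessThan_iff inj_eq zero_le)
    obtain v where v: "v < n" "p v \<noteq> v"
      using p by (metis atLeastLessThan_iff eq_id_iff permutes_def zero_le)
    have "(f ^^ k) v < n \<and> p ((f ^^ k) v) \<noteq> (f ^^ k) v" for k
      by (induction k) (use v step in auto)
    then have "(f ^^ k) v \<noteq> 0" for k
      using step by blast
    then show False
      using assms v(1) unfolding parent_maps_def by blast
  qed
  have "det ?A = (\<Sum>p | p permutes {0..<n}. signof p * (\<Prod>i = 0..<n. ?A $$ (i, p i)))"
    by (rule det_def') (simp add: parent_matrix_def)
  also have "\<dots> = (\<Sum>p\<in>{id}. signof p * (\<Prod>i = 0..<n. ?A $$ (i, p i)))"
  proof (rule sum.mono_neutral_right)
    show "\<forall>p\<in>{p. p permutes {0..<n}} - {id}. signof p * (\<Prod>i = 0..<n. ?A $$ (i, p i)) = 0"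
    proof
      fix p assume "p \<in> {p. p permutes {0..<n}} - {id}"
      then have "(\<Prod>i = 0..<n. ?A $$ (i, p i)) = 0" by (intro moved) auto
      then show "signof p * (\<Prod>i = 0..<n. ?A $$ (i, p i)) = 0" by simp
    qed
  qed (simp_all add: finite_permutations permutes_id)
  also have "\<dots> = (\<Prod>i = 0..<n. ?A $$ (i, i))"
    by simp
  also have "\<dots> = (\<Prod>i = 0..<n. 1)"
  proof (rule prod.cong)
    fix i assume "i \<in> {0..<n}"
    then show "?A $$ (i, i) = 1"
      using no_fix[of i] by (auto simp: parent_matrix_def)
  qed simp
  finally show ?thesis by simp
qed

text \<open>
  The indicator vector of the vertices that never reach the root is in the kernel, because a
  vertex belongs to this set if and only if its parent does.
\<close>

lemma det_parent_matrix_cyclic: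
  assumes "0 < n" "\<And>v. v < n \<Longrightarrow> f v < n" "f 0 = 0" "v < n" "\<And>k. (f ^^ k) v \<noteq> 0"
  shows "det (parent_matrix n f) = 0"
proof -
  let ?A = "parent_matrix n f"
  define C where "C = {v. \<forall>k. (f ^^ k) v \<noteq> 0}"
  have "0 \<notin> C" unfolding C_def by (auto intro!: exI[of _ 0])
  have C_iff: "f u \<in> C \<longleftrightarrow> u \<in> C" for u
  proof
    assume "u \<in> C"
    then have "(f ^^ Suc k) u \<noteq> 0" for k
      unfolding C_def by blast
    then show "f u \<in> C"
      by (simp add: C_def funpow_swap1)
  next
    assume *: "f u \<in> C"
    have "(f ^^ k) u \<noteq> 0" for k
    proof (cases k)
      case 0
      then show ?thesis using * \<open>0 \<notin> C\<close> assms(3) by (cases "u = 0") auto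
    next
      case (Suc k')
      then show ?thesis using * by (simp add: C_def funpow_swap1)
    qed
    then show "u \<in> C" by (simp add: C_def)
  qed
  define x :: "int vec" where "x = vec n (\<lambda>u. of_bool (u \<in> C))"
  have "?A *\<^sub>v x = 0\<^sub>v n"
  proof (rule eq_vecI)
    fix i assume "i < dim_vec (0\<^sub>v n :: int vec)"
    then have i: "i < n" by simp
    have "(?A *\<^sub>v x) $ i = (\<Sum>u = 0..<n. ?A $$ (i, u) * of_bool (u \<in> C))"
      using i by (simp add: parent_matrix_def x_def scalar_prod_def)
    also have "\<dots> = (\<Sum>u = 0..<n. of_bool (u = i) * of_bool (u \<in> C)
        - (if i = 0 then 0 else of_bool (u = f i) * of_bool (u \<in> C)))"
      using i by (intro sum.cong) (auto simp: parent_matrix_def)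
    also have "\<dots> = of_bool (i \<in> C) - (if i = 0 then 0 else of_bool (f i \<in> C))"
      using i assms(2)[OF i]
      by (simp add: sum_subtractf of_bool_def if_distrib[of "\<lambda>x. x * _"] sum.delta cong: if_cong)
    also have "\<dots> = 0"
      using \<open>0 \<notin> C\<close> C_iff by simp
    finally show "(?A *\<^sub>v x) $ i = 0\<^sub>v n $ i"
      using i by simp
  qed (simp add: parent_matrix_def)
  moreover have "x \<noteq> 0\<^sub>v n"
  proof
    assume "x = 0\<^sub>v n"
    then have "x $ v = 0" using assms(4) by simp
    then show False using assms(4,5) by (simp add: x_def C_def)
  qed
  moreover have "?A \<in> carrier_mat n n" "x \<in> carrier_vec n"
    by (simp_all add: parent_matrix_def x_def)
  ultimately show ?thesis
    using det_0_iff_vec_prod_zero by blast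
qed

text \<open>
  Expanding each row as a sum over the neighbours turns the determinant into a sum over all
  ways to select a neighbour for each non-root vertex. A selection contributes one if following
  it always leads to the root and zero otherwise.
\<close>

lemma det_reduced_laplacian:
  assumes "0 < n" and E: "E \<subseteq> {0..<n} \<times> {0..<n}"
  shows "det (reduced_laplacian n E) = int (card (parent_maps n E))"
proof -
  \<comment> \<open>Non-neighbours receive the zero vector, so that every row is a sum over all vertices.\<close>
  define a :: "nat \<Rightarrow> nat \<Rightarrow> int vec" where "a v w = vec n (\<lambda>u.
    if v = 0 then of_bool (w = 0 \<and> u = 0)
    else if (v, w) \<in> E then of_bool (u = v) - of_bool (u = w) else 0)" for v w
  let ?F = "{f. (\<forall>v\<in>{0..<n}. f v \<in> {0..<n}) \<and> (\<forall>v. v \<notin> {0..<n} \<longrightarrow> f v = v)}"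
  let ?D = "\<lambda>f. det (mat\<^sub>r n n (\<lambda>v. a v (f v)))"
  have a: "a \<in> {0..<n} \<rightarrow> {0..<n} \<rightarrow> carrier_vec n"
    by (auto simp: a_def)
  have "reduced_laplacian n E = mat\<^sub>r n n (\<lambda>v. finsum_vec TYPE(int) n (a v) {0..<n})"
  proof (rule eq_matI)
    fix v u assume "v < dim_row (mat\<^sub>r n n (\<lambda>v. finsum_vec TYPE(int) n (a v) {0..<n}))"
      and "u < dim_col (mat\<^sub>r n n (\<lambda>v. finsum_vec TYPE(int) n (a v) {0..<n}))"
    then have vu: "v < n" "u < n" by auto
    then have "finsum_vec TYPE(int) n (a v) {0..<n} $ u = (\<Sum>w = 0..<n. a v w $ u)"
      using a by (intro index_finsum_vec) auto
    also have "\<dots> = reduced_laplacian n E $$ (v, u)"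
    proof (cases "v = 0")
      case True
      then show ?thesis
        using vu by (auto simp: a_def reduced_laplacian_def of_bool_def)
    next
      case False
      have "{w. (v, w) \<in> E} = {0..<n} \<inter> {w. (v, w) \<in> E}"
        using E by auto
      then show ?thesis
        using vu False by (simp add: a_def reduced_laplacian_def sum.If_cases)
    qed
    finally show "reduced_laplacian n E $$ (v, u)
        = mat\<^sub>r n n (\<lambda>v. finsum_vec TYPE(int) n (a v) {0..<n}) $$ (v, u)"
      using vu by simp
  qed (auto simp: reduced_laplacian_def)
  then have "det (reduced_laplacian n E) = (\<Sum>f\<in>?F. ?D f)"
    using det_linear_rows_sum[OF _ a] by simp
  also have "\<dots> = (\<Sum>f\<in>parent_maps n E. 1)"
  proof (rule sum.mono_neutral_cong_right)
    show "finite ?F"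
      by (rule finite_bounded_functions) auto
    show "parent_maps n E \<subseteq> ?F"
      using parent_maps_less[OF _ E] by (auto simp: parent_maps_def)
  next
    have eq: "mat\<^sub>r n n (\<lambda>v. a v (f v)) = parent_matrix n f"
      if "f 0 = 0" "\<And>v. v \<in> {1..<n} \<Longrightarrow> (v, f v) \<in> E" for f
      using that by (intro eq_matI) (auto simp: a_def parent_matrix_def)
    show "?D f = 1" if "f \<in> parent_maps n E" for f
      using det_parent_matrix_acyclic[OF that] eq[of f] that by (simp add: parent_maps_def)
    show "\<forall>f\<in>?F - parent_maps n E. ?D f = 0"
    proof
      fix f assume f: "f \<in> ?F - parent_maps n E"
      show "?D f = 0"
      proof (cases "f 0 = 0 \<and> (\<forall>v\<in>{1..<n}. (v, f v) \<in> E)")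
        case True
        have "\<not> (\<forall>v<n. \<exists>k. (f ^^ k) v = 0)"
        proof
          assume "\<forall>v<n. \<exists>k. (f ^^ k) v = 0"
          moreover have "f v = v" if "v \<notin> {1..<n}" for v
            using True f that by (cases "v = 0") auto
          ultimately have "f \<in> parent_maps n E"
            using True by (simp add: parent_maps_def)
          then show False using f by simp
        qed
        then obtain v where v: "v < n" "\<forall>k. (f ^^ k) v \<noteq> 0"
          by auto
        then have "det (parent_matrix n f) = 0"
        proof (intro det_parent_matrix_cyclic[OF \<open>0 < n\<close>])
          show "f v < n" if "v < n" for v using f that by simp
          show "f 0 = 0" using True by blast
          show "v < n" "(f ^^ k) v \<noteq> 0" for k using v by simp_all
        qed
        then show ?thesis
          using eq[of f] True by simp
      next
        case False
        then obtain v where v: "v < n" "v = 0 \<and> f v \<noteq> 0 \<or> v \<noteq> 0 \<and> (v, f v) \<notin> E"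
          using \<open>0 < n\<close> by (cases "f 0 = 0") (force, blast)
        then have "a v (f v) = 0\<^sub>v n"
          by (auto simp: a_def)
        then have "mat\<^sub>r n n (\<lambda>i. a i (f i)) = mat\<^sub>r n n (\<lambda>i. if i = v then 0\<^sub>v n else a i (f i))"
          by (intro eq_matI) auto
        moreover have "(\<lambda>i. a i (f i)) \<in> {0..<n} \<rightarrow> carrier_vec n"
          by (auto simp: a_def)
        ultimately show ?thesis
          using v(1) by (simp add: det_row_0)
      qed
    qed
  qed
  finally show ?thesis by simp
qed

theorem matrix_tree:
  assumes "pair_graph G" and "pverts G = {0..<n}" and "0 < n"
  shows "int (num_spanning_trees G) = det (reduced_laplacian n (parcs G))"
proof -
  interpret G: pair_graph G by fact
  have "parcs G \<subseteq> {0..<n} \<times> {0..<n}"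
    using G.wellformed assms(2) by auto
  then show ?thesis
    using det_reduced_laplacian[OF assms(3)] num_spanning_trees_eq_card_parent_maps[OF assms] by simp
qed

section \<open>Roots of unity and the Fourier matrix\<close>

definition unit_root :: "nat \<Rightarrow> int \<Rightarrow> complex" where
  "unit_root n x = cis (2 * pi * real_of_int x / real n)"

lemma unit_root_add: "unit_root n (x + y) = unit_root n x * unit_root n y"
  by (simp add: unit_root_def cis_mult add_divide_distrib distrib_left)

lemma unit_root_0 [simp]: "unit_root n 0 = 1"
  by (simp add: unit_root_def)

lemma unit_root_nonzero [simp]: "unit_root n x \<noteq> 0"
  by (simp add: unit_root_def)

lemma unit_root_minus: "unit_root n (- x) = inverse (unit_root n x)"
  by (simp add: unit_root_def)

lemma unit_root_power: "unit_root n x ^ k = unit_root n (x * int k)"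
  by (induction k) (simp_all add: unit_root_add algebra_simps)

lemma unit_root_eq_1_iff:
  assumes "0 < n"
  shows "unit_root n x = 1 \<longleftrightarrow> int n dvd x"
proof
  assume "unit_root n x = 1"
  then have "cos (2 * pi * real_of_int x / real n) = 1"
    by (simp add: unit_root_def complex_eq_iff)
  then obtain k :: int where "2 * pi * real_of_int x / real n = of_int k * 2 * pi"
    by (auto simp: cos_one_2pi_int)
  then have "real_of_int x = real_of_int (k * int n)"
    using assms by (simp add: field_simps)
  then show "int n dvd x"
    by (simp only: of_int_eq_iff) simp
next
  assume "int n dvd x"
  then obtain k where "x = int n * k" ..
  then show "unit_root n x = 1"
    using assms cis_multiple_2pi[of "of_int k"] by (simp add: unit_root_def mult_ac)
qed

lemma unit_root_cong:
  assumes "[x = y] (mod int n)" "0 < n"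
  shows "unit_root n x = unit_root n y"
proof -
  have "unit_root n (x - y) = 1"
    using assms by (simp add: unit_root_eq_1_iff cong_iff_dvd_diff)
  then show ?thesis
    using unit_root_add[of n "x - y" y] by simp
qed

lemma sum_unit_root:
  assumes "0 < n"
  shows "(\<Sum>l<n. unit_root n (x * int l)) = (if int n dvd x then of_nat n else 0)"
proof -
  have "(\<Sum>l<n. unit_root n (x * int l)) = (\<Sum>l<n. unit_root n x ^ l)"
    by (simp add: unit_root_power)
  also have "\<dots> = (if int n dvd x then of_nat n else 0)"
  proof (cases "int n dvd x")
    case True
    then show ?thesis using unit_root_eq_1_iff[OF assms, of x] by simp
  next
    case False
    then have "unit_root n x \<noteq> 1" using unit_root_eq_1_iff[OF assms, of x] by simp
    moreover have "unit_root n x ^ n = 1"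
      using unit_root_eq_1_iff[OF assms, of "x * int n"] by (simp add: unit_root_power)
    ultimately show ?thesis using False by (simp add: geometric_sum)
  qed
  finally show ?thesis .
qed

text \<open>
  The nontrivial \<open>n\<close>-th roots of unity are the roots of \<open>1 + x + \<dots> + x\<^bsup>n-1\<^esup>\<close>; the identity is the
  factorization of this polynomial evaluated at one.
\<close>

lemma prod_one_minus_unit_root:
  assumes "0 < n"
  shows "(\<Prod>j = 1..<n. 1 - unit_root n (int j)) = of_nat n"
proof -
  let ?p = "\<Prod>j = 1..<n. [:- unit_root n (int j), 1:]"
  let ?q = "\<Sum>l<n. monom (1::complex) l"
  let ?A = "(\<lambda>j. unit_root n (int j)) ` {1..<n}"
  have inj: "inj_on (\<lambda>j. unit_root n (int j)) {1..<n}"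
  proof (rule inj_onI)
    fix i j assume ij: "i \<in> {1..<n}" "j \<in> {1..<n}" and eq: "unit_root n (int i) = unit_root n (int j)"
    have "unit_root n (int i - int j) = 1"
      using eq unit_root_add[of n "int i - int j" "int j"] by simp
    then have "int n dvd int i - int j"
      using unit_root_eq_1_iff[OF assms] by simp
    then show "i = j"
      using ij zdvd_imp_le[of "int n" "int i - int j"] zdvd_imp_le[of "int n" "int j - int i"]
      by (cases i j rule: linorder_cases) (auto simp: dvd_diff_commute)
  qed
  have deg_p: "degree ?p = n - 1"
    by (subst degree_prod_eq_sum_degree) auto
  have "lead_coeff ?p = 1"
    by (simp add: lead_coeff_prod)
  have "?p = ?q"
  proof (rule poly_eqI_degree_lead_coeff[where n = "n - 1" and A = ?A])
    have "coeff ?q (n - 1) = (\<Sum>l<n. if l = n - 1 then 1 else 0)"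
      by (simp add: coeff_sum)
    then show "coeff ?p (n - 1) = coeff ?q (n - 1)"
      using \<open>lead_coeff ?p = 1\<close> assms unfolding deg_p by simp
    show "n - 1 \<le> card ?A"
      using inj by (simp add: card_image)
    show "degree ?p \<le> n - 1"
      using deg_p by simp
    show "degree ?q \<le> n - 1"
      by (rule degree_sum_le) (auto intro: order.trans[OF degree_monom_le])
  next
    fix z assume "z \<in> ?A"
    then obtain j where j: "j \<in> {1..<n}" "z = unit_root n (int j)" by auto
    have "poly ?p z = 0"
      using j by (auto simp: poly_prod)
    moreover have "\<not> int n dvd int j"
      using j(1) by (auto dest: zdvd_imp_le)
    then have "poly ?q z = 0"
      using sum_unit_root[OF assms, of "int j"] j(2)
      by (simp add: poly_sum poly_monom unit_root_power)
    ultimately show "poly ?p z = poly ?q z" by simp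
  qed
  then have "poly ?p 1 = poly ?q 1" by simp
  then show ?thesis
    by (simp add: poly_prod poly_sum poly_monom)
qed

lemma det_scale_columns:
  fixes A :: "'a :: comm_ring_1 mat"
  assumes A: "A \<in> carrier_mat n n"
  shows "det (mat n n (\<lambda>(i, j). A $$ (i, j) * d j)) = det A * (\<Prod>j<n. d j)"
proof -
  have "mat n n (\<lambda>(i, j). A $$ (i, j) * d j) = A * mat_diag n d"
    using mat_diag_mult_right[OF A, of d] by simp
  moreover have "det (mat_diag n d) = (\<Prod>j<n. d j)"
  proof -
    have "upper_triangular (mat_diag n d)"
      by (auto simp: mat_diag_def)
    then have "det (mat_diag n d) = prod_list (diag_mat (mat_diag n d))"
      by (rule det_upper_triangular[where n = n]) simp
    also have "\<dots> = (\<Prod>j = 0..<n. d j)"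
      by (simp add: prod_list_diag_prod mat_diag_def)
    finally show ?thesis
      by (simp add: atLeast0LessThan)
  qed
  ultimately show ?thesis
    using det_mult[OF A, of "mat_diag n d"] by simp
qed

definition fourier_mat :: "nat \<Rightarrow> complex mat" where
  "fourier_mat n = mat n n (\<lambda>(i, j). unit_root n (int i * int j))"

lemma fourier_mat_carrier [simp]: "fourier_mat n \<in> carrier_mat n n"
  by (simp add: fourier_mat_def)

lemma inverse_fourier_mat:
  assumes "0 < n"
  shows "mat n n (\<lambda>(i, j). unit_root n (- (int i * int j))) * fourier_mat n = of_nat n \<cdot>\<^sub>m 1\<^sub>m n"
proof (rule eq_matI)
  fix i j assume "i < dim_row (of_nat n \<cdot>\<^sub>m 1\<^sub>m n :: complex mat)" "j < dim_col (of_nat n \<cdot>\<^sub>m 1\<^sub>m n :: complex mat)"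
  then have ij: "i < n" "j < n" by auto
  have "(mat n n (\<lambda>(i, j). unit_root n (- (int i * int j))) * fourier_mat n) $$ (i, j)
      = (\<Sum>l<n. unit_root n (- (int i * int l)) * unit_root n (int l * int j))"
    using ij by (simp add: fourier_mat_def scalar_prod_def atLeast0LessThan)
  also have "\<dots> = (\<Sum>l<n. unit_root n ((int j - int i) * int l))"
    by (simp add: algebra_simps flip: unit_root_add)
  also have "\<dots> = (if int n dvd int j - int i then of_nat n else 0)"
    using sum_unit_root[OF assms] .
  also have "int n dvd int j - int i \<longleftrightarrow> i = j"
    using ij zdvd_imp_le[of "int n" "int i - int j"] zdvd_imp_le[of "int n" "int j - int i"]
    by (cases i j rule: linorder_cases) (auto simp: dvd_diff_commute)
  finally show "(mat n n (\<lambda>(i, j). unit_root n (- (int i * int j))) * fourier_mat n) $$ (i, j)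
      = (of_nat n \<cdot>\<^sub>m 1\<^sub>m n) $$ (i, j)"
    using ij by auto
qed (auto simp: fourier_mat_def)

text \<open>
  The inverse of the Fourier matrix has \<open>1/n\<close> in its corner, and by Cramer's rule this entry is
  the quotient of the corner cofactor by the determinant.
\<close>

lemma
  assumes "0 < n"
  shows det_fourier_mat: "det (fourier_mat n) \<noteq> 0"
    and cofactor_fourier_mat: "of_nat n * cofactor (fourier_mat n) 0 0 = det (fourier_mat n)"
proof -
  let ?F = "fourier_mat n"
  define H where "H = mat n n (\<lambda>(i, j). unit_root n (- (int i * int j)))"
  have H: "H \<in> carrier_mat n n" by (simp add: H_def)
  have HF: "H * ?F = of_nat n \<cdot>\<^sub>m 1\<^sub>m n"
    unfolding H_def by (rule inverse_fourier_mat) fact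
  have "det H * det ?F = of_nat n ^ n"
    using det_mult[OF H, of ?F] HF by simp
  then show "det ?F \<noteq> 0"
    using assms by auto
  have adj: "adj_mat ?F \<in> carrier_mat n n"
    using adj_mat(1)[of ?F n] by simp
  have "of_nat n \<cdot>\<^sub>m adj_mat ?F = (H * ?F) * adj_mat ?F"
    using adj mult_smult_assoc_mat[of "1\<^sub>m n" n n "adj_mat ?F" n "of_nat n"] by (simp add: HF)
  also have "\<dots> = H * (?F * adj_mat ?F)"
    using H adj by (intro assoc_mult_mat) auto
  also have "\<dots> = det ?F \<cdot>\<^sub>m H"
    using H adj_mat(2)[of ?F n]
      mult_smult_distrib[OF H, of "1\<^sub>m n" n "det ?F"] by simp
  finally have "(of_nat n \<cdot>\<^sub>m adj_mat ?F) $$ (0, 0) = (det ?F \<cdot>\<^sub>m H) $$ (0, 0)"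
    by simp
  then show "of_nat n * cofactor ?F 0 0 = det ?F"
    using assms adj H by (simp add: H_def adj_mat_def fourier_mat_def)
qed

text \<open>
  Here \<open>A\<close> agrees with a matrix diagonalized by the Fourier basis except in the row of the root,
  which is \<open>e\<^sub>0\<close>. Multiplying by the Fourier matrix \<open>F\<close> gives \<open>F\<close> with scaled columns, except in
  the first row. As the eigenvalue of the constant vector is zero, the first column of the
  product is \<open>e\<^sub>0\<close>, so its determinant is the corner cofactor of \<open>F\<close>, which is \<open>det F / n\<close>, times
  the remaining eigenvalues.
\<close>

lemma det_rooted_circulant:
  fixes A :: "complex mat" and lam :: "nat \<Rightarrow> complex"
  assumes "0 < n" and A: "A \<in> carrier_mat n n"
    and root: "\<And>u. u < n \<Longrightarrow> A $$ (0, u) = of_bool (u = 0)"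
    and eigen: "\<And>v j. \<lbrakk>v \<in> {1..<n}; j < n\<rbrakk> \<Longrightarrow>
      (\<Sum>u<n. A $$ (v, u) * unit_root n (int u * int j)) = unit_root n (int v * int j) * lam j"
    and "lam 0 = 0"
  shows "of_nat n * det A = (\<Prod>j = 1..<n. lam j)"
proof -
  let ?F = "fourier_mat n"
  define G where "G = A * ?F"
  have G: "G \<in> carrier_mat n n"
    using A by (simp add: G_def)
  have G_entry: "G $$ (v, j) = (\<Sum>u<n. A $$ (v, u) * unit_root n (int u * int j))" if "v < n" "j < n" for v j
    using that A by (simp add: G_def fourier_mat_def scalar_prod_def atLeast0LessThan)
  have G00: "G $$ (0, 0) = 1"
    using assms(1) root by (simp add: G_entry of_bool_def)
  have G_lower: "G $$ (v, j) = ?F $$ (v, j) * lam j" if "v \<in> {1..<n}" "j < n" for v j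
    using that eigen by (simp add: G_entry fourier_mat_def)
  have "det G = (\<Sum>i<n. G $$ (i, 0) * cofactor G i 0)"
    using G assms(1) by (rule laplace_expansion_column)
  also have "\<dots> = (\<Sum>i\<in>{0}. G $$ (i, 0) * cofactor G i 0)"
    using assms(1,5) G_lower by (intro sum.mono_neutral_right) auto
  also have "\<dots> = det (mat_delete G 0 0)"
    using G00 by (simp add: cofactor_def)
  also have "mat_delete G 0 0
      = mat (n - 1) (n - 1) (\<lambda>(i, j). mat_delete ?F 0 0 $$ (i, j) * lam (Suc j))"
    using G G_lower by (intro eq_matI) (auto simp: mat_delete_def fourier_mat_def)
  also have "det \<dots> = det (mat_delete ?F 0 0) * (\<Prod>j<n - 1. lam (Suc j))"
    by (rule det_scale_columns) (rule mat_delete_carrier, simp)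
  also have "(\<Prod>j<n - 1. lam (Suc j)) = (\<Prod>j = 1..<n. lam j)"
    by (rule prod.reindex_bij_witness[of _ "\<lambda>j. j - 1" Suc]) auto
  also have "det (mat_delete ?F 0 0) = cofactor ?F 0 0"
    by (simp add: cofactor_def)
  finally have "of_nat n * (det A * det ?F) = (of_nat n * cofactor ?F 0 0) * (\<Prod>j = 1..<n. lam j)"
    using det_mult[OF A, of ?F] by (simp add: G_def)
  then show ?thesis
    using det_fourier_mat[OF assms(1)] by (simp add: cofactor_fourier_mat[OF assms(1)])
qed

section \<open>Spanning trees of circulant graphs\<close>

definition laplacian_eigenvalue :: "nat \<Rightarrow> nat set \<Rightarrow> nat \<Rightarrow> complex" where
  "laplacian_eigenvalue n S j =
     (\<Sum>s\<in>S. 2 - unit_root n (int j * int s) - unit_root n (- (int j * int s)))"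

text \<open>
  This is the eigenvalue at the \<open>j\<close>-th root of unity \<open>z\<close> of the quotient of the Laplacian of the
  circulant graph by the Laplacian of the cycle: the Laurent polynomial
  \<open>\<Sum>s (2 - z\<^sup>s - z\<^bsup>-s\<^esup>) / (2 - z - z\<^bsup>-1\<^esup>)\<close>, whose summand is the product of
  \<open>1 + z + \<dots> + z\<^bsup>s-1\<^esup>\<close> with its conjugate.
\<close>

definition quotient_eigenvalue :: "nat \<Rightarrow> nat set \<Rightarrow> nat \<Rightarrow> complex" where
  "quotient_eigenvalue n S j =
     (\<Sum>s\<in>S. \<Sum>a<s. \<Sum>b<s. unit_root n (int j * (int a - int b)))"

lemma int_dvd_small:
  assumes "int n dvd x" "\<bar>x\<bar> < int n"
  shows "x = 0"
proof (rule ccontr)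
  assume "x \<noteq> 0"
  with dvd_imp_le_int[OF this assms(1)] assms(2) show False by simp
qed

text \<open>
  Since \<open>2 s < n\<close> for all \<open>s\<close> in \<open>S\<close>, the \<open>2 |S|\<close> shifts by \<open>\<plusminus> s\<close> lead to pairwise different
  vertices.
\<close>

lemma sum_circulant_neighbours:
  fixes g :: "int \<Rightarrow> 'a :: comm_monoid_add"
  assumes "finite S" and S: "\<And>s. s \<in> S \<Longrightarrow> 0 < s \<and> 2 * s < n" and "v < n"
    and per: "\<And>x y. [x = y] (mod int n) \<Longrightarrow> g x = g y"
  shows "(\<Sum>w | (v, w) \<in> parcs (circulant n S). g (int w))
    = (\<Sum>s\<in>S. g (int v + int s) + g (int v - int s))"
proof -
  have "0 < n" using assms(3) by simp
  define up where "up s = nat ((int v + int s) mod int n)" for s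
  define dn where "dn s = nat ((int v - int s) mod int n)" for s
  have int_up: "int (up s) = (int v + int s) mod int n" for s
    using \<open>0 < n\<close> by (simp add: up_def)
  have int_dn: "int (dn s) = (int v - int s) mod int n" for s
    using \<open>0 < n\<close> by (simp add: dn_def)
  have less: "up s < n" "dn s < n" for s
    using \<open>0 < n\<close> by (simp_all add: up_def dn_def nat_less_iff)
  have eq_iff: "w = w' \<longleftrightarrow> [int w = int w'] (mod int n)" if "w < n" "w' < n" for w w'
    using that by (simp add: cong_def)
  have "{w. (v, w) \<in> parcs (circulant n S)} = up ` S \<union> dn ` S"
  proof (intro equalityI subsetI)
    fix w assume "w \<in> {w. (v, w) \<in> parcs (circulant n S)}"
    then obtain s where s: "s \<in> S" "w < n"
      and "[int w = int v + int s] (mod int n) \<or> [int w = int v - int s] (mod int n)"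
      by (auto simp: circulant_def)
    then have "w = up s \<or> w = dn s"
      using less by (simp add: eq_iff int_up int_dn cong_def)
    then show "w \<in> up ` S \<union> dn ` S" using s(1) by blast
  next
    fix w assume "w \<in> up ` S \<union> dn ` S"
    then obtain s where s: "s \<in> S" "w = up s \<or> w = dn s" by blast
    have "[int (up s) = int v + int s] (mod int n)" "[int (dn s) = int v - int s] (mod int n)"
      by (simp_all add: int_up int_dn cong_def)
    then show "w \<in> {w. (v, w) \<in> parcs (circulant n S)}"
      using s less[of s] assms(3) by (auto simp: circulant_def)
  qed
  moreover have "inj_on up S"
  proof (rule inj_onI)
    fix s t assume st: "s \<in> S" "t \<in> S" "up s = up t"
    then have "[int v + int s = int v + int t] (mod int n)"
      unfolding cong_def int_up[symmetric] by simp
    then have "int n dvd int s - int t"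
      by (simp add: cong_iff_dvd_diff)
    then show "s = t"
      using int_dvd_small[of n "int s - int t"] S[OF st(1)] S[OF st(2)] by auto
  qed
  moreover have "inj_on dn S"
  proof (rule inj_onI)
    fix s t assume st: "s \<in> S" "t \<in> S" "dn s = dn t"
    then have "[int v - int s = int v - int t] (mod int n)"
      unfolding cong_def int_dn[symmetric] by simp
    then have "int n dvd int t - int s"
      by (simp add: cong_iff_dvd_diff)
    then show "s = t"
      using int_dvd_small[of n "int t - int s"] S[OF st(1)] S[OF st(2)] by auto
  qed
  moreover have "up ` S \<inter> dn ` S = {}"
  proof (rule ccontr)
    assume "up ` S \<inter> dn ` S \<noteq> {}"
    then obtain s t where st: "s \<in> S" "t \<in> S" "up s = dn t" by auto
    then have "[int v + int s = int v - int t] (mod int n)"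
      unfolding cong_def int_up[symmetric] int_dn[symmetric] by simp
    then have "int n dvd int s + int t"
      by (simp add: cong_iff_dvd_diff)
    then show False
      using int_dvd_small[of n "int s + int t"] S[OF st(1)] S[OF st(2)] by auto
  qed
  ultimately have "(\<Sum>w | (v, w) \<in> parcs (circulant n S). g (int w))
    = (\<Sum>s\<in>S. g (int (up s))) + (\<Sum>s\<in>S. g (int (dn s)))"
    using assms(1) by (simp add: sum.union_disjoint sum.reindex)
  also have "\<dots> = (\<Sum>s\<in>S. g (int v + int s)) + (\<Sum>s\<in>S. g (int v - int s))"
    using per by (intro arg_cong2[where f = plus] sum.cong) (auto simp: int_up int_dn)
  finally show ?thesis by (simp add: sum.distrib)
qed

lemma laplacian_eigenvector:
  assumes "finite S" and S: "\<And>s. s \<in> S \<Longrightarrow> 0 < s \<and> 2 * s < n" and v: "v \<in> {1..<n}"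
  shows "(\<Sum>u<n. of_int (reduced_laplacian n (parcs (circulant n S)) $$ (v, u)) * unit_root n (int u * int j))
    = unit_root n (int v * int j) * laplacian_eigenvalue n S j"
proof -
  let ?e = "\<lambda>x. unit_root n (x * int j)"
  let ?N = "{w. (v, w) \<in> parcs (circulant n S)}"
  have "0 < n" using v by simp
  have per: "?e x = ?e y" if "[x = y] (mod int n)" for x y
    using that \<open>0 < n\<close> by (intro unit_root_cong cong_mult) auto
  have N: "?N \<subseteq> {..<n}"
    by (auto simp: circulant_def)
  have "(\<Sum>u<n. of_int (reduced_laplacian n (parcs (circulant n S)) $$ (v, u)) * ?e (int u))
    = (\<Sum>u<n. \<Sum>w\<in>?N. (of_bool (u = v) - of_bool (u = w)) * ?e (int u))"
    using v by (simp add: reduced_laplacian_def sum_distrib_right)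
  also have "\<dots> = (\<Sum>w\<in>?N. \<Sum>u<n. (of_bool (u = v) - of_bool (u = w)) * ?e (int u))"
    by (rule sum.swap)
  also have "\<dots> = (\<Sum>w\<in>?N. ?e (int v) - ?e (int w))"
    using v N by (intro sum.cong) (auto simp: left_diff_distrib sum_subtractf of_bool_def if_distrib[of "\<lambda>x. x * _"] cong: if_cong)
  also have "\<dots> = (\<Sum>s\<in>S. (?e (int v) - ?e (int v + int s)) + (?e (int v) - ?e (int v - int s)))"
    using per v assms by (intro sum_circulant_neighbours) auto
  also have "\<dots> = ?e (int v) * laplacian_eigenvalue n S j"
    unfolding laplacian_eigenvalue_def sum_distrib_left
  proof (rule sum.cong)
    fix s assume "s \<in> S"
    have "?e (int v + int s) = ?e (int v) * unit_root n (int j * int s)"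
      by (simp add: algebra_simps flip: unit_root_add)
    moreover have "?e (int v - int s) = ?e (int v) * unit_root n (- (int j * int s))"
      by (simp add: algebra_simps flip: unit_root_add)
    ultimately show "?e (int v) - ?e (int v + int s) + (?e (int v) - ?e (int v - int s))
      = ?e (int v) * (2 - unit_root n (int j * int s) - unit_root n (- (int j * int s)))"
      by (simp add: algebra_simps)
  qed simp
  finally show ?thesis .
qed

lemma quotient_eigenvalue_altdef:
  "quotient_eigenvalue n S j =
     (\<Sum>s\<in>S. (\<Sum>a<s. unit_root n (int j) ^ a) * (\<Sum>b<s. unit_root n (- int j) ^ b))"
  unfolding quotient_eigenvalue_def sum_product
  by (intro sum.cong refl)
    (simp add: unit_root_power right_diff_distrib flip: unit_root_add)

lemma laplacian_eigenvalue_factor: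
  "laplacian_eigenvalue n S j
     = (1 - unit_root n (int j)) * (1 - unit_root n (- int j)) * quotient_eigenvalue n S j"
  unfolding laplacian_eigenvalue_def quotient_eigenvalue_altdef
proof (subst sum_distrib_left, rule sum.cong)
  fix s
  let ?x = "unit_root n (int j)" and ?y = "unit_root n (- int j)"
  have "?x * ?y = 1"
    by (simp flip: unit_root_add)
  then have "?x ^ s * ?y ^ s = 1"
    by (simp flip: power_mult_distrib)
  moreover have "(1 - ?x) * (\<Sum>a<s. ?x ^ a) = 1 - ?x ^ s" "(1 - ?y) * (\<Sum>a<s. ?y ^ a) = 1 - ?y ^ s"
    by (simp_all add: one_diff_power_eq)
  ultimately have factors: "?x ^ s * ?y ^ s = 1" "(1 - ?x) * (\<Sum>a<s. ?x ^ a) = 1 - ?x ^ s"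
      "(1 - ?y) * (\<Sum>b<s. ?y ^ b) = 1 - ?y ^ s"
    by blast+
  have "(1 - ?x) * (1 - ?y) * ((\<Sum>a<s. ?x ^ a) * (\<Sum>b<s. ?y ^ b))
    = ((1 - ?x) * (\<Sum>a<s. ?x ^ a)) * ((1 - ?y) * (\<Sum>b<s. ?y ^ b))"
    by (simp only: mult_ac)
  also have "\<dots> = 2 - ?x ^ s - ?y ^ s"
    unfolding factors(2,3) using factors(1) by (simp add: left_diff_distrib right_diff_distrib)
  finally have "2 - ?x ^ s - ?y ^ s = (1 - ?x) * (1 - ?y) * ((\<Sum>a<s. ?x ^ a) * (\<Sum>b<s. ?y ^ b))"
    by simp
  then show "2 - unit_root n (int j * int s) - unit_root n (- (int j * int s))
    = (1 - ?x) * (1 - ?y) * ((\<Sum>a<s. ?x ^ a) * (\<Sum>b<s. ?y ^ b))"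
    by (simp add: unit_root_power)
qed simp

lemma prod_one_minus_unit_root_minus:
  assumes "0 < n"
  shows "(\<Prod>j = 1..<n. 1 - unit_root n (- int j)) = of_nat n"
proof -
  have "(\<Prod>j = 1..<n. 1 - unit_root n (- int j)) = cnj (\<Prod>j = 1..<n. 1 - unit_root n (int j))"
    by (simp add: unit_root_def cis_cnj)
  then show ?thesis
    by (simp only: prod_one_minus_unit_root[OF assms] complex_cnj_of_nat)
qed

text \<open>
  The product of the eigenvalues of the Laplacian of the cycle at the nontrivial roots of unity
  is \<open>n\<^sup>2\<close>. One factor \<open>n\<close> is absorbed by the matrix-tree theorem and the other one stays.
\<close>

lemma num_spanning_trees_circulant:
  assumes "finite S" "\<And>s. s \<in> S \<Longrightarrow> 0 < s \<and> 2 * s < n" "0 < n"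
  shows "of_nat (num_spanning_trees (circulant n S)) = of_nat n * (\<Prod>j = 1..<n. quotient_eigenvalue n S j)"
proof -
  let ?L = "reduced_laplacian n (parcs (circulant n S))"
  let ?A = "map_mat of_int ?L :: complex mat"
  have L: "?L \<in> carrier_mat n n"
    by (simp add: reduced_laplacian_def)
  have tau: "of_nat (num_spanning_trees (circulant n S)) = det ?A"
  proof -
    have "int (num_spanning_trees (circulant n S)) = det ?L"
      using assms by (intro matrix_tree pair_graph_circulant) (auto simp: circulant_def)
    then have "of_int (int (num_spanning_trees (circulant n S))) = (of_int (det ?L) :: complex)"
      by simp
    then show ?thesis by (simp add: of_int_hom.hom_det)
  qed
  have "of_nat n * det ?A = (\<Prod>j = 1..<n. laplacian_eigenvalue n S j)"
  proof (rule det_rooted_circulant[OF \<open>0 < n\<close>])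
    show "?A \<in> carrier_mat n n" using L by simp
    show "?A $$ (0, u) = of_bool (u = 0)" if "u < n" for u
      using that \<open>0 < n\<close> L by (simp add: reduced_laplacian_def)
    show "(\<Sum>u<n. ?A $$ (v, u) * unit_root n (int u * int j)) = unit_root n (int v * int j) * laplacian_eigenvalue n S j"
      if "v \<in> {1..<n}" for v j
      using laplacian_eigenvector[OF assms(1,2) that, of j] L that by simp
    show "laplacian_eigenvalue n S 0 = 0"
      by (simp add: laplacian_eigenvalue_def)
  qed
  also have "\<dots> = of_nat n * (of_nat n * (\<Prod>j = 1..<n. quotient_eigenvalue n S j))"
    by (simp only: laplacian_eigenvalue_factor prod.distrib prod_one_minus_unit_root[OF \<open>0 < n\<close>]
        prod_one_minus_unit_root_minus[OF \<open>0 < n\<close>] mult.assoc)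
  finally show ?thesis
    using \<open>0 < n\<close> by (simp add: tau)
qed

lemma quotient_eigenvalue_reflect:
  assumes "j \<le> n" "0 < n"
  shows "quotient_eigenvalue n S (n - j) = quotient_eigenvalue n S j"
proof -
  have "unit_root n (int (n - j) * (int a - int b)) = unit_root n (int j * (int b - int a))" for a b
    using assms by (intro unit_root_cong) (simp_all add: cong_iff_dvd_diff of_nat_diff algebra_simps)
  then have "quotient_eigenvalue n S (n - j)
    = (\<Sum>s\<in>S. \<Sum>a<s. \<Sum>b<s. unit_root n (int j * (int b - int a)))"
    by (simp add: quotient_eigenvalue_def)
  also have "\<dots> = quotient_eigenvalue n S j"
    unfolding quotient_eigenvalue_def by (intro sum.cong refl sum.swap)
  finally show ?thesis .
qed

text \<open>
  At \<open>j = n div 2\<close> the root of unity is \<open>-1\<close>, and \<open>1 - 1 + 1 - \<dots>\<close> with \<open>s\<close> terms is one for odd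
  \<open>s\<close> and zero for even \<open>s\<close>.
\<close>

lemma quotient_eigenvalue_half:
  assumes "even n" "0 < n" "finite S"
  shows "quotient_eigenvalue n S (n div 2) = of_nat (card {s \<in> S. odd s})"
proof -
  have "unit_root n (int (n div 2)) = -1"
    using assms(1,2) by (elim evenE) (simp add: unit_root_def)
  moreover have "(\<Sum>a<s. (-1) ^ a :: complex) = of_bool (odd s)" for s :: nat
    by (induction s) auto
  ultimately have "quotient_eigenvalue n S (n div 2) = (\<Sum>s\<in>S. of_bool (odd s))"
    unfolding quotient_eigenvalue_altdef unit_root_minus by (intro sum.cong) auto
  also have "\<dots> = of_nat (card {s \<in> S. odd s})"
    using assms(3) by (simp add: sum.If_cases of_bool_def Int_def)
  finally show ?thesis .
qed

text \<open>
  The reflection \<open>j \<mapsto> n - j\<close> pairs the indices below the middle with those above it and fixes at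
  most the middle one. The lemma serves for both sums and products.
\<close>

lemma (in comm_monoid_set) reflect_halves:
  fixes n :: nat
  assumes sym: "\<And>j. j \<in> {1..<n} \<Longrightarrow> g (n - j) = g j" and "0 < n"
  defines "m \<equiv> (n - 1) div 2"
  shows "F g {1..<n} = f (f (F g {1..m}) (F g {1..m})) (if even n then g (n div 2) else \<^bold>1)"
proof -
  let ?mid = "if even n then {n div 2} else {}"
  have split: "{1..<n} = ({1..m} \<union> (\<lambda>j. n - j) ` {1..m}) \<union> ?mid"
  proof (intro equalityI subsetI)
    fix j assume j: "j \<in> {1..<n}"
    consider "j \<le> m" | "n - j \<le> m" | "even n" "j = n div 2"
      using j unfolding m_def by (cases "even n") (auto elim!: evenE oddE, linarith+)
    then show "j \<in> ({1..m} \<union> (\<lambda>j. n - j) ` {1..m}) \<union> ?mid"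
    proof cases
      case 2
      then have "j = n - (n - j)" "n - j \<in> {1..m}" using j by auto
      then show ?thesis by blast
    qed (use j in auto)
  qed (use assms(2) in \<open>auto simp: m_def split: if_splits\<close>)
  have disj1: "{1..m} \<inter> (\<lambda>j. n - j) ` {1..m} = {}"
    by (auto simp: m_def)
  have disj2: "({1..m} \<union> (\<lambda>j. n - j) ` {1..m}) \<inter> ?mid = {}"
    by (auto simp: m_def elim!: evenE)
  have "inj_on (\<lambda>j. n - j) {1..m}"
    by (auto simp: inj_on_def m_def)
  then have "F g ((\<lambda>j. n - j) ` {1..m}) = F (\<lambda>j. g (n - j)) {1..m}"
    by (simp add: reindex)
  also have "\<dots> = F g {1..m}"
    using sym by (intro cong) (auto simp: m_def)
  finally have refl: "F g ((\<lambda>j. n - j) ` {1..m}) = F g {1..m}" .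
  have "F g {1..<n} = f (f (F g {1..m}) (F g ((\<lambda>j. n - j) ` {1..m}))) (F g ?mid)"
    unfolding split by (subst union_disjoint; (subst union_disjoint)?) (use disj1 disj2 in auto)
  then show ?thesis
    unfolding refl by simp
qed

section \<open>Integrality of the half product\<close>

text \<open>
  The sine of \<open>2 * pi * x / n\<close> up to the constant factor \<open>2 * \<i>\<close>, which would only clutter the
  computations with roots of unity.
\<close>

definition sine :: "nat \<Rightarrow> int \<Rightarrow> complex" where
  "sine n x = unit_root n x - unit_root n (- x)"

text \<open>
  The quotient of the two Laplacians acts on the antisymmetric functions on the integers modulo
  \<open>n\<close>, that is, those with \<open>f (- x) = - f x\<close>. They are determined by their values on
  \<open>{1..(n - 1) div 2}\<close>, and this is the integer matrix of the action in these coordinates, with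
  indices shifted by one.
\<close>

definition half_circulant :: "nat \<Rightarrow> nat set \<Rightarrow> int mat" where
  "half_circulant n S = mat ((n - 1) div 2) ((n - 1) div 2) (\<lambda>(i, l).
     \<Sum>s\<in>S. \<Sum>a<s. \<Sum>b<s.
       of_bool (int n dvd int (Suc i) + (int a - int b) - int (Suc l))
       - of_bool (int n dvd int (Suc i) + (int a - int b) + int (Suc l)))"

lemma sine_minus: "sine n (- x) = - sine n x"
  by (simp add: sine_def)

lemma sine_cong:
  assumes "[x = y] (mod int n)" "0 < n"
  shows "sine n x = sine n y"
proof -
  have "[- x = - y] (mod int n)"
    using assms(1) by (simp add: cong_minus_minus_iff)
  then show ?thesis
    using assms by (simp add: sine_def unit_root_cong)
qed

lemma sine_eq_0:
  assumes "int n dvd 2 * x" "0 < n"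
  shows "sine n x = 0"
proof -
  have "[x = - x] (mod int n)"
    using assms(1) by (simp add: cong_iff_dvd_diff)
  then show ?thesis
    using unit_root_cong[OF _ assms(2)] by (simp add: sine_def)
qed

text \<open>
  An antisymmetric function at an arbitrary point equals plus or minus its value at a point of
  \<open>{1..(n - 1) div 2}\<close>, or zero if the point is its own mirror image modulo \<open>n\<close>.
\<close>

lemma sine_interpolation:
  assumes "0 < n"
  defines "m \<equiv> (n - 1) div 2"
  shows "(\<Sum>l<m. (of_bool (int n dvd x - int (Suc l)) - of_bool (int n dvd x + int (Suc l))) * sine n (int (Suc l) * y))
    = sine n (x * y)"
proof -
  define r where "r = nat (x mod int n)"
  have r: "r < n" "int r = x mod int n"
    using assms(1) by (simp_all add: r_def nat_less_iff)
  then have xr: "[x = int r] (mod int n)"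
    by (simp add: cong_def)
  have minus_iff: "int n dvd x - int (Suc l) \<longleftrightarrow> Suc l = r" if "l < m" for l
  proof -
    have "int n dvd x - int (Suc l) \<longleftrightarrow> [x = int (Suc l)] (mod int n)"
      by (simp only: cong_iff_dvd_diff)
    also have "\<dots> \<longleftrightarrow> int r = int (Suc l)"
      using that r unfolding cong_def m_def by simp
    finally show ?thesis by auto
  qed
  have plus_iff: "int n dvd x + int (Suc l) \<longleftrightarrow> Suc l = n - r" if "l < m" for l
  proof -
    have "int n dvd x + int (Suc l) \<longleftrightarrow> [x = int (n - Suc l)] (mod int n)"
    proof -
      have "x - int (n - Suc l) = x + int (Suc l) - int n"
        using that unfolding m_def by (simp add: of_nat_diff)
      then show ?thesis
        by (simp only: cong_iff_dvd_diff dvd_diff_left_iff dvd_refl)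
    qed
    also have "\<dots> \<longleftrightarrow> int r = int (n - Suc l)"
    proof -
      have "int (n - Suc l) mod int n = int (n - Suc l)"
        using assms(1) by (intro mod_pos_pos_trivial) simp_all
      then show ?thesis
        unfolding cong_def r(2) by (simp only:)
    qed
    also have "\<dots> \<longleftrightarrow> Suc l = n - r"
      using that r(1) unfolding m_def by auto
    finally show ?thesis .
  qed
  have pick: "(\<Sum>l<m. of_bool (Suc l = t) * sine n (int (Suc l) * y)) = (if t \<in> {1..m} then sine n (int t * y) else 0)" for t
  proof (cases t)
    case (Suc t')
    have "(\<Sum>l<m. of_bool (Suc l = t) * sine n (int (Suc l) * y)) = (\<Sum>l<m. if l = t' then sine n (int t * y) else 0)"
      using Suc by (intro sum.cong) auto
    then show ?thesis using Suc by (simp add: Suc_le_eq)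
  qed simp
  have "(\<Sum>l<m. (of_bool (int n dvd x - int (Suc l)) - of_bool (int n dvd x + int (Suc l))) * sine n (int (Suc l) * y))
    = (\<Sum>l<m. of_bool (Suc l = r) * sine n (int (Suc l) * y)) - (\<Sum>l<m. of_bool (Suc l = n - r) * sine n (int (Suc l) * y))"
    unfolding sum_subtractf[symmetric] by (intro sum.cong) (simp_all only: minus_iff plus_iff lessThan_iff left_diff_distrib)
  also have "\<dots> = (if r \<in> {1..m} then sine n (int r * y) else 0) - (if n - r \<in> {1..m} then sine n (int (n - r) * y) else 0)"
    by (simp only: pick)
  also have "\<dots> = sine n (int r * y)"
  proof -
    have "[int (n - r) * y = - (int r * y)] (mod int n)"
      using r(1) by (simp add: cong_iff_dvd_diff of_nat_diff algebra_simps)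
    then have refl: "sine n (int (n - r) * y) = - sine n (int r * y)"
      using sine_cong[OF _ assms(1)] sine_minus by metis
    consider "r \<in> {1..m}" | "n - r \<in> {1..m}" | "r = 0" | "2 * r = n"
      using r(1) unfolding m_def by fastforce
    then show ?thesis
    proof cases
      case 1
      then have "n - r \<notin> {1..m}" unfolding m_def by auto
      then show ?thesis using 1 by (simp del: atLeastAtMost_iff)
    next
      case 2
      then have "r \<notin> {1..m}" unfolding m_def by auto
      then show ?thesis using 2 refl by (simp del: atLeastAtMost_iff)
    next
      case 3
      then have "sine n (int r * y) = 0" by (simp add: sine_def)
      moreover have "n - r \<notin> {1..m}" "r \<notin> {1..m}" using 3 assms(1) unfolding m_def by auto
      ultimately show ?thesis by (simp del: atLeastAtMost_iff)
    next
      case 4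
      have "2 * (int r * y) = int n * y" using 4 by auto
      then have "int n dvd 2 * (int r * y)" by (simp only: dvd_triv_left)
      then have "sine n (int r * y) = 0" using assms(1) by (rule sine_eq_0)
      moreover have "n - r \<notin> {1..m}" "r \<notin> {1..m}" using 4 assms(1) unfolding m_def by auto
      ultimately show ?thesis by (simp del: atLeastAtMost_iff)
    qed
  qed
  also have "\<dots> = sine n (x * y)"
    using xr assms(1) by (intro sine_cong cong_mult) (auto simp: cong_sym)
  finally show ?thesis .
qed

text \<open>
  The summand is invariant under \<open>l \<mapsto> n - l\<close>, so twice the sum is a sum over all residues, to
  which the orthogonality of the roots of unity applies.
\<close>

lemma sine_orthogonality:
  assumes "0 < n"
  defines "m \<equiv> (n - 1) div 2"
  assumes ij: "i \<in> {1..m}" "j \<in> {1..m}"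
  shows "(\<Sum>l = 1..m. sine n (int i * int l) * sine n (int l * int j)) = (if i = j then - of_nat n else 0)"
proof -
  let ?g = "\<lambda>l::nat. sine n (int i * int l) * sine n (int l * int j)"
  have g_reflect: "?g (n - l) = ?g l" if "l \<in> {1..<n}" for l
  proof -
    have "[int (n - l) * x = - (int l * x)] (mod int n)" for x
      using that by (simp add: cong_iff_dvd_diff of_nat_diff algebra_simps)
    then have "sine n (int (n - l) * x) = - sine n (int l * x)" for x
      using sine_cong[OF _ assms(1)] sine_minus by metis
    then show ?thesis by (simp add: mult.commute[of "int i"])
  qed
  have g_half: "?g (n div 2) = 0" if "even n"
  proof -
    have "int n dvd 2 * (int i * int (n div 2))"
      using that by (elim evenE) (simp add: mult.left_commute)
    then show ?thesis using sine_eq_0[OF _ assms(1)] by simp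
  qed
  have "2 * (\<Sum>l = 1..m. ?g l) = (\<Sum>l = 1..<n. ?g l)"
    using sum.reflect_halves[of n ?g, OF g_reflect assms(1)] g_half unfolding m_def by simp
  also have "\<dots> = (\<Sum>l<n. ?g l)"
    using assms(1) by (intro sum.mono_neutral_left) (auto simp: sine_def Suc_le_eq)
  also have "\<dots> = (\<Sum>l<n. unit_root n ((int i + int j) * int l) + unit_root n ((- int i - int j) * int l)
      - unit_root n ((int i - int j) * int l) - unit_root n ((int j - int i) * int l))"
    by (intro sum.cong refl)
      (simp add: sine_def algebra_simps flip: unit_root_add)
  also have "\<dots> = (if int n dvd int i + int j then of_nat n else 0) + (if int n dvd - int i - int j then of_nat n else 0)
      - (if int n dvd int i - int j then of_nat n else 0) - (if int n dvd int j - int i then of_nat n else 0)"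
    by (simp only: sum.distrib sum_subtractf sum_unit_root[OF assms(1)])
  also have "\<dots> = (if i = j then - 2 * of_nat n else 0)"
  proof -
    have "i + j < n" "0 < i" "0 < j"
      using ij unfolding m_def by auto
    then have "\<not> int n dvd int i + int j"
      using int_dvd_small[of n "int i + int j"] by auto
    moreover from this have "\<not> int n dvd - int i - int j"
      by (metis dvd_minus_iff minus_add_distrib uminus_add_conv_diff add.commute)
    moreover have "int n dvd int i - int j \<longleftrightarrow> i = j"
      using int_dvd_small[of n "int i - int j"] \<open>i + j < n\<close> by auto
    moreover have "int n dvd int j - int i \<longleftrightarrow> i = j"
      using int_dvd_small[of n "int j - int i"] \<open>i + j < n\<close> by auto
    ultimately show ?thesis by simp
  qed
  finally show ?thesis by (simp split: if_splits)
qed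

text \<open>
  The sine vectors are eigenvectors of the half circulant with eigenvalues
  \<open>quotient_eigenvalue n S j\<close> for \<open>j\<close> in \<open>{1..(n - 1) div 2}\<close>, and they form a basis since the
  square of the sine matrix is a nonzero multiple of the identity. So this product of
  eigenvalues, each of which is only an algebraic integer, is an integer.
\<close>

lemma det_half_circulant:
  assumes "0 < n"
  shows "of_int (det (half_circulant n S)) = (\<Prod>j = 1..(n - 1) div 2. quotient_eigenvalue n S j)"
proof -
  define m where "m = (n - 1) div 2"
  define R where "R = mat m m (\<lambda>(i, j). sine n (int (Suc i) * int (Suc j)))"
  let ?B = "map_mat of_int (half_circulant n S) :: complex mat"
  have R: "R \<in> carrier_mat m m" by (simp add: R_def)
  have B: "?B \<in> carrier_mat m m" by (simp add: half_circulant_def m_def)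
  have "R * R = - of_nat n \<cdot>\<^sub>m 1\<^sub>m m"
  proof (rule eq_matI)
    fix i j assume "i < dim_row (- of_nat n \<cdot>\<^sub>m 1\<^sub>m m :: complex mat)" "j < dim_col (- of_nat n \<cdot>\<^sub>m 1\<^sub>m m :: complex mat)"
    then have ij: "i < m" "j < m" by auto
    have "(R * R) $$ (i, j) = (\<Sum>l<m. sine n (int (Suc i) * int (Suc l)) * sine n (int (Suc l) * int (Suc j)))"
      using ij by (simp add: R_def scalar_prod_def atLeast0LessThan)
    also have "\<dots> = (\<Sum>l = 1..m. sine n (int (Suc i) * int l) * sine n (int l * int (Suc j)))"
      by (rule sum.reindex_bij_witness[of _ "\<lambda>l. l - 1" Suc]) auto
    also have "\<dots> = (if Suc i = Suc j then - of_nat n else 0)"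
      unfolding m_def by (rule sine_orthogonality[OF assms]) (use ij in \<open>auto simp: m_def\<close>)
    finally show "(R * R) $$ (i, j) = (- of_nat n \<cdot>\<^sub>m 1\<^sub>m m) $$ (i, j)"
      using ij by simp
  qed (simp_all add: R_def)
  then have "det R * det R = (- of_nat n) ^ m"
    using det_mult[OF R R] by simp
  then have "det R \<noteq> 0"
    using assms by auto
  have "?B * R = mat m m (\<lambda>(i, j). R $$ (i, j) * quotient_eigenvalue n S (Suc j))"
  proof (rule eq_matI)
    fix i j assume "i < dim_row (mat m m (\<lambda>(i, j). R $$ (i, j) * quotient_eigenvalue n S (Suc j)))"
      "j < dim_col (mat m m (\<lambda>(i, j). R $$ (i, j) * quotient_eigenvalue n S (Suc j)))"
    then have ij: "i < m" "j < m" by auto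
    let ?x = "\<lambda>a b. int (Suc i) + (int a - int b)" and ?y = "int (Suc j)"
    let ?c = "\<lambda>l a b. of_bool (int n dvd ?x a b - int (Suc l)) - of_bool (int n dvd ?x a b + int (Suc l)) :: complex"
    let ?e = "unit_root n (int (Suc i) * ?y)" and ?e' = "unit_root n (- (int (Suc i) * ?y))"
    have "(?B * R) $$ (i, j) = (\<Sum>l<m. (\<Sum>s\<in>S. \<Sum>a<s. \<Sum>b<s. ?c l a b) * sine n (int (Suc l) * ?y))"
      using ij by (simp add: R_def half_circulant_def m_def scalar_prod_def atLeast0LessThan)
    also have "\<dots> = (\<Sum>s\<in>S. \<Sum>a<s. \<Sum>b<s. \<Sum>l<m. ?c l a b * sine n (int (Suc l) * ?y))"
      unfolding sum_distrib_right
      by (subst sum.swap, rule sum.cong[OF refl], subst sum.swap, rule sum.cong[OF refl],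
          subst sum.swap, rule sum.cong[OF refl], rule refl)
    also have "\<dots> = (\<Sum>s\<in>S. \<Sum>a<s. \<Sum>b<s. sine n (?x a b * ?y))"
      unfolding m_def by (simp only: sine_interpolation[OF assms])
    also have "\<dots> = (\<Sum>s\<in>S. (\<Sum>a<s. \<Sum>b<s. ?e * unit_root n (?y * (int a - int b)))
        - (\<Sum>a<s. \<Sum>b<s. ?e' * unit_root n (?y * (int b - int a))))"
    proof -
      have "sine n (?x a b * ?y) = ?e * unit_root n (?y * (int a - int b)) - ?e' * unit_root n (?y * (int b - int a))" for a b
      proof -
        have "?x a b * ?y = int (Suc i) * ?y + ?y * (int a - int b)"
          "- (?x a b * ?y) = - (int (Suc i) * ?y) + ?y * (int b - int a)"
          by (simp_all only: algebra_simps)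
        then show ?thesis
          unfolding sine_def by (simp only: unit_root_add)
      qed
      then show ?thesis by (simp only: sum_subtractf)
    qed
    \<comment> \<open>Exchanging the roles of \<open>a\<close> and \<open>b\<close>: the quotient polynomial is palindromic.\<close>
    also have "\<dots> = (\<Sum>s\<in>S. (\<Sum>a<s. \<Sum>b<s. ?e * unit_root n (?y * (int a - int b)))
        - (\<Sum>a<s. \<Sum>b<s. ?e' * unit_root n (?y * (int a - int b))))"
      by (intro sum.cong refl arg_cong2[where f = minus] sum.swap)
    also have "\<dots> = (?e - ?e') * quotient_eigenvalue n S (Suc j)"
      by (simp only: quotient_eigenvalue_def sum_subtractf left_diff_distrib sum_distrib_left)
    finally show "(?B * R) $$ (i, j)
        = mat m m (\<lambda>(i, j). R $$ (i, j) * quotient_eigenvalue n S (Suc j)) $$ (i, j)"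
      using ij by (simp add: R_def sine_def)
  qed (simp_all add: R_def half_circulant_def m_def)
  then have "det (?B * R) = det R * (\<Prod>j<m. quotient_eigenvalue n S (Suc j))"
    using det_scale_columns[OF R] by (simp only:)
  moreover have "det (?B * R) = det R * det ?B"
    using det_mult[OF B R] by (simp only: mult.commute)
  ultimately have "det ?B = (\<Prod>j<m. quotient_eigenvalue n S (Suc j))"
    using mult_left_cancel[OF \<open>det R \<noteq> 0\<close>] by metis
  also have "\<dots> = (\<Prod>j = 1..m. quotient_eigenvalue n S j)"
    by (rule prod.reindex_bij_witness[of _ "\<lambda>j. j - 1" Suc]) auto
  finally show ?thesis
    by (simp add: m_def of_int_hom.hom_det)
qed

lemma num_spanning_trees_circulant_square:
  assumes "finite S" "\<And>s. s \<in> S \<Longrightarrow> 0 < s \<and> 2 * s < n" "0 < n"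
  shows "int (num_spanning_trees (circulant n S))
    = int n * (det (half_circulant n S))\<^sup>2 * (if even n then int (card {s \<in> S. odd s}) else 1)"
proof -
  let ?mu = "quotient_eigenvalue n S"
  have "(\<Prod>j = 1..<n. ?mu j) = (\<Prod>j = 1..(n - 1) div 2. ?mu j) * (\<Prod>j = 1..(n - 1) div 2. ?mu j)
      * (if even n then ?mu (n div 2) else 1)"
    using assms(3) by (intro prod.reflect_halves quotient_eigenvalue_reflect) auto
  also have "\<dots> = of_int ((det (half_circulant n S))\<^sup>2 * (if even n then int (card {s \<in> S. odd s}) else 1))"
    using quotient_eigenvalue_half[OF _ assms(3,1)]
    by (simp add: power2_eq_square det_half_circulant[OF assms(3)] flip: One_nat_def)
  finally have "(of_int (int (num_spanning_trees (circulant n S))) :: complex)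
    = of_int (int n * ((det (half_circulant n S))\<^sup>2 * (if even n then int (card {s \<in> S. odd s}) else 1)))"
    using num_spanning_trees_circulant[OF assms] by simp
  then show ?thesis
    by (simp only: of_int_eq_iff mult.assoc)
qed

theorem theorem3:
  fixes k :: nat and s :: "nat \<Rightarrow> nat" and p q :: nat
  assumes "1 \<le> k" and "1 \<le> s 1" and "strict_mono_on {1..k} s"
    and "p = card {j \<in> {1..k}. odd (s j)}"
    and "q = squarefree_part p"
  shows "\<exists>a :: nat \<Rightarrow> int. \<forall>n.
    2 * s k < n \<and> Digraph_Component.connected (with_proj (circulant n (s ` {1..k}))) \<longrightarrow>
      (odd n \<longrightarrow>
        int (num_spanning_trees (circulant n (s ` {1..k}))) = int n * (a n)\<^sup>2) \<and>
      (even n \<longrightarrow>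
        int (num_spanning_trees (circulant n (s ` {1..k}))) = int q * int n * (a n)\<^sup>2)"
proof -
  let ?S = "s ` {1..k}"
  have "inj_on s {1..k}"
    using assms(3) by (rule strict_mono_on_imp_inj_on)
  then have "inj_on s {j \<in> {1..k}. odd (s j)}"
    by (rule inj_on_subset) auto
  moreover have "{t \<in> ?S. odd t} = s ` {j \<in> {1..k}. odd (s j)}"
    by auto
  ultimately have p: "card {t \<in> ?S. odd t} = p"
    by (simp add: card_image assms(4))
  have pq: "int p = int q * (int (square_part p))\<^sup>2"
    using squarefree_decompose[of p] unfolding assms(5) by (metis of_nat_mult of_nat_power)
  have bounds: "1 \<le> s j \<and> s j \<le> s k" if "j \<in> {1..k}" for j
  proof -
    have "mono_on {1..k} s"
      using assms(3) by (rule strict_mono_on_imp_mono_on)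
    then have "s 1 \<le> s j" "s j \<le> s k"
      using that assms(1) by (auto intro: mono_onD)
    then show ?thesis using assms(2) by simp
  qed
  \<comment> \<open>For even \<open>n\<close> the eigenvalue at \<open>-1\<close> contributes \<open>p\<close>, whose square part goes into \<open>a n\<close>.\<close>
  define a where "a n = (if even n then int (square_part p) else 1) * det (half_circulant n ?S)" for n
  have "(odd n \<longrightarrow> int (num_spanning_trees (circulant n ?S)) = int n * (a n)\<^sup>2) \<and>
    (even n \<longrightarrow> int (num_spanning_trees (circulant n ?S)) = int q * int n * (a n)\<^sup>2)"
    if n: "2 * s k < n" for n
  proof -
    have "0 < t \<and> 2 * t < n" if "t \<in> ?S" for t
      using that bounds n by fastforce
    then have "int (num_spanning_trees (circulant n ?S))
      = int n * (det (half_circulant n ?S))\<^sup>2 * (if even n then int p else 1)"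
      using num_spanning_trees_circulant_square[of ?S n, unfolded p] n by simp
    then show ?thesis
      by (simp add: a_def pq power_mult_distrib)
  qed
  then show ?thesis by blast
qed

end
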